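(* Let $G$ be a bipartite matching covered graph. Then $G\in\mathfrak{B}$ if and only if $G$ is (isomorphic to) one of $K_2^*$, $C_4^2$, $C_4^4$, $K_{3,3}$, or an even cycle $C_{2n}$ ($n\ge 2$).
   Context: Graphs are finite, loopless, and may have parallel edges (parallel edges are distinct edges, so perfect matchings differing only by the choice of a parallel edge are different). An edge is a $k$-matching edge if it belongs to exactly $k$ perfect matchings of the graph. A connected graph is matching covered if every edge belongs to at least one perfect matching. $\mathfrak{B}$ is the class of connected graphs (admitting a perfect matching) in which every edge is either a $1$-matching edge or a $2$-matching edge, and no perfect matching contains both a $1$-matching edge and a $2$-matching edge. $K_2^*$ denotes any graph on two vertices with one or more parallel edges joining them. $C_{2n}$ is the cycle with $2n$ vertices. $C_4^2$ is the graph obtained from the $4$-cycle by doubling (i.e. giving multiplicity $2$ to) each of two opposite (nonadjacent) edges; it is $3$-regular. $C_4^4$ is the graph obtained from the $4$-cycle by doubling every edge; it is $4$-regular. $K_{3,3}$ is the complete bipartite graph. *)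

theory Defs
  imports Main
begin

text \<open>
  Finite loopless undirected graphs with parallel edges. Edges are objects of their own and
  \<open>ends e\<close> is the set of the two end vertices of \<open>e\<close>, so parallel edges are distinct edges
  with the same value of \<open>ends\<close>.
\<close>

record ('v, 'e) pre_multigraph =
  verts :: "'v set"
  edges :: "'e set"
  ends :: "'e \<Rightarrow> 'v set"

locale multigraph =
  fixes G :: "('v, 'e) pre_multigraph"
  assumes finite_verts: "finite (verts G)"
    and finite_edges: "finite (edges G)"
    and ends_in_verts: "e \<in> edges G \<Longrightarrow> ends G e \<subseteq> verts G"
    and two_ends: "e \<in> edges G \<Longrightarrow> card (ends G e) = 2"

definition adjacency :: "('v, 'e) pre_multigraph \<Rightarrow> ('v \<times> 'v) set" where
  "adjacency G = {(u, v). \<exists>e\<in>edges G. ends G e = {u, v}}"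

definition connected_graph :: "('v, 'e) pre_multigraph \<Rightarrow> bool" where
  "connected_graph G \<longleftrightarrow>
     verts G \<noteq> {} \<and> (\<forall>u\<in>verts G. \<forall>v\<in>verts G. (u, v) \<in> (adjacency G)\<^sup>*)"

definition bipartite :: "('v, 'e) pre_multigraph \<Rightarrow> bool" where
  "bipartite G \<longleftrightarrow>
     (\<exists>A B. A \<union> B = verts G \<and> A \<inter> B = {} \<and>
        (\<forall>e\<in>edges G. \<exists>a\<in>A. \<exists>b\<in>B. ends G e = {a, b}))"

definition matching :: "('v, 'e) pre_multigraph \<Rightarrow> 'e set \<Rightarrow> bool" where
  "matching G M \<longleftrightarrow>
     M \<subseteq> edges G \<and> (\<forall>e\<in>M. \<forall>f\<in>M. e \<noteq> f \<longrightarrow> ends G e \<inter> ends G f = {})"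

definition perfect_matching :: "('v, 'e) pre_multigraph \<Rightarrow> 'e set \<Rightarrow> bool" where
  "perfect_matching G M \<longleftrightarrow> matching G M \<and> (\<Union>e\<in>M. ends G e) = verts G"

definition k_matching_edge :: "('v, 'e) pre_multigraph \<Rightarrow> nat \<Rightarrow> 'e \<Rightarrow> bool" where
  "k_matching_edge G k e \<longleftrightarrow>
     e \<in> edges G \<and> card {M. perfect_matching G M \<and> e \<in> M} = k"

definition matching_covered :: "('v, 'e) pre_multigraph \<Rightarrow> bool" where
  "matching_covered G \<longleftrightarrow>
     connected_graph G \<and> (\<forall>e\<in>edges G. \<exists>M. perfect_matching G M \<and> e \<in> M)"

definition class_B :: "('v, 'e) pre_multigraph set" where
  "class_B = {G. multigraph G \<and> connected_graph G \<and> (\<exists>M. perfect_matching G M) \<and>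
     (\<forall>e\<in>edges G. k_matching_edge G 1 e \<or> k_matching_edge G 2 e) \<and>
     \<not> (\<exists>M. perfect_matching G M \<and>
          (\<exists>e\<in>M. \<exists>f\<in>M. k_matching_edge G 1 e \<and> k_matching_edge G 2 f))}"

definition graph_iso ::
  "('v, 'e) pre_multigraph \<Rightarrow> ('w, 'f) pre_multigraph \<Rightarrow> bool" (infix \<open>\<cong>\<^sub>g\<close> 50) where
  "G \<cong>\<^sub>g H \<longleftrightarrow>
     (\<exists>\<phi> \<psi>. bij_betw \<phi> (verts G) (verts H) \<and> bij_betw \<psi> (edges G) (edges H) \<and>
        (\<forall>e\<in>edges G. ends H (\<psi> e) = \<phi> ` ends G e))"

definition K2_star :: "nat \<Rightarrow> (nat, nat) pre_multigraph" where
  "K2_star m = \<lparr>verts = {0, 1}, edges = {..<m}, ends = (\<lambda>_. {0, 1})\<rparr>"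

text \<open>Edge \<open>i\<close> joins vertices \<open>i\<close> and \<open>i + 1\<close> modulo \<open>k\<close>; this is a cycle for \<open>k \<ge> 2\<close>.\<close>

definition cycle_graph :: "nat \<Rightarrow> (nat, nat) pre_multigraph" where
  "cycle_graph k =
     \<lparr>verts = {..<k}, edges = {..<k}, ends = (\<lambda>i. {i, Suc i mod k})\<rparr>"

text \<open>Every edge \<open>e\<close> is replaced by \<open>\<mu> e\<close> parallel copies \<open>(e, 0), \<dots>, (e, \<mu> e - 1)\<close>.\<close>

definition multiply_edges ::
  "('e \<Rightarrow> nat) \<Rightarrow> ('v, 'e) pre_multigraph \<Rightarrow> ('v, 'e \<times> nat) pre_multigraph" where
  "multiply_edges \<mu> G =
     \<lparr>verts = verts G, edges = Sigma (edges G) (\<lambda>e. {..<\<mu> e}), ends = (\<lambda>(e, _). ends G e)\<rparr>"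

definition C4_2 :: "(nat, nat \<times> nat) pre_multigraph" where
  "C4_2 = multiply_edges (\<lambda>i. if i \<in> {0, 2} then 2 else 1) (cycle_graph 4)"

definition C4_4 :: "(nat, nat \<times> nat) pre_multigraph" where
  "C4_4 = multiply_edges (\<lambda>_. 2) (cycle_graph 4)"

definition complete_bipartite :: "nat \<Rightarrow> nat \<Rightarrow> (nat + nat, nat \<times> nat) pre_multigraph" where
  "complete_bipartite m n =
     \<lparr>verts = {..<m} <+> {..<n}, edges = {..<m} \<times> {..<n}, ends = (\<lambda>(i, j). {Inl i, Inr j})\<rparr>"

end

(*
Contract a perfect matching M: the edges outside M become arcs of a digraph on the vertices of one
colour class, and the perfect matchings correspond to the sets K of arcs ("circ K") that form
vertex-disjoint directed cycles, with M itself corresponding to the empty set.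

If every edge of M is a 1-matching edge, then every nonempty such K is spanning. So all cycles are
Hamiltonian, all arcs follow one cyclic order, and counting transversals bounds the multiplicities.

If all edges are 2-matching edges, then every vertex is avoided by exactly one nonempty K and every
arc lies in exactly two. With at least three vertices no two such K are disjoint: the union of two
disjoint ones is spanning, and a closed walk through both yields a third one that avoids some
vertex together with one of them. So, changing M if necessary, the graph is simple, and it is
regular. If C avoids v and f is an arc of C, then deleting v and f leaves an acyclic digraph; its
source can only be the head of f, of in-degree two, with one arc coming from v. Dually for the tail.
Hence v and C make up the whole digraph, which has three vertices.
*)
theory Submission
  imports Defs "HOL-Combinatorics.Orbits"
begin

text \<open>Forbidding mixed perfect matchings is what makes the two cases exhaustive: a perfect
  matching through a 1-matching edge consists of 1-matching edges only, and if there is no such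
  edge, any \<open>M\<close> will do. Counting through \<open>M\<close> works because the empty arc
  set, which stands for \<open>M\<close>, avoids every vertex: an edge of \<open>M\<close> in
  exactly k perfect matchings leaves k - 1 nonempty arc sets that avoid its vertex. Edges parallel
  to an edge of \<open>M\<close> turn into loops outside \<open>M\<close>, so the digraph has to
  keep loops and parallel arcs. With a single vertex nothing but loops is left, in any number, which
  is \<open>K2_star\<close>. Two vertices are the exceptional size: the arguments that bound
  multiplicities need a vertex outside two given ones. This is why multiple edges survive there, in
  \<open>C4_2\<close> and \<open>C4_4\<close>, and not in larger graphs.\<close>

subsection \<open>Contracting a perfect matching\<close>

text \<open>With colour classes \<open>A\<close>, \<open>B\<close> and ends \<open>a e\<close>,
  \<open>b e\<close> these are the perfect matchings. Keeping two vertex sets and two end maps as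
  parameters lets the case \<open>A = B\<close> describe the contracted digraph, where the same edge
  sets are those with one arc leaving and one arc entering every vertex.\<close>

definition factor ::
  "'a set \<Rightarrow> 'b set \<Rightarrow> 'e set \<Rightarrow> ('e \<Rightarrow> 'a) \<Rightarrow> ('e \<Rightarrow> 'b) \<Rightarrow> 'e set \<Rightarrow> bool" where
  "factor A B E a b N \<longleftrightarrow> N \<subseteq> E \<and> bij_betw a N A \<and> bij_betw b N B"

text \<open>The last assumption is connectivity in cut form: if no edge leaves the vertices in
  \<open>S\<close> and \<open>T\<close>, a nonempty \<open>S\<close> is all of \<open>A\<close>.
  Unlike a statement about paths, it passes to the contraction by taking a preimage of
  \<open>T\<close>.\<close>

locale covered_system =
  fixes A :: "'a set" and B :: "'b set" and E :: "'e set" and a :: "'e \<Rightarrow> 'a" and b :: "'e \<Rightarrow> 'b"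
  assumes finite_A: "finite A"
    and finite_E: "finite E"
    and A_nonempty: "A \<noteq> {}"
    and a_in: "e \<in> E \<Longrightarrow> a e \<in> A"
    and b_in: "e \<in> E \<Longrightarrow> b e \<in> B"
    and covered: "e \<in> E \<Longrightarrow> \<exists>N. factor A B E a b N \<and> e \<in> N"
    and connected: "S \<subseteq> A \<Longrightarrow> T \<subseteq> B \<Longrightarrow> S \<noteq> {} \<Longrightarrow> (\<And>e. e \<in> E \<Longrightarrow> a e \<in> S \<longleftrightarrow> b e \<in> T) \<Longrightarrow> S = A"

locale arc_system = covered_system V V E t h
  for V :: "'v set" and E :: "'e set" and t h :: "'e \<Rightarrow> 'v" +
  fixes M :: "'e set"
  assumes M_factor: "factor V V E t h M"
    and M_loops: "e \<in> M \<Longrightarrow> h e = t e"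

text \<open>\<open>g\<close> sends a vertex of \<open>B\<close> to its partner under
  \<open>M\<close>. Composing with a bijection changes no factor, so counts of factors are
  independent of the contracted matching. This serves both to contract the bipartite graph and, with
  both classes equal to \<open>V\<close>, to exchange the contracted matching later.\<close>

lemma (in covered_system)
  assumes M: "factor A B E a b M"
  defines "g \<equiv> \<lambda>y. a (inv_into M b y)"
  shows rebase_factor: "factor A A E a (\<lambda>e. g (b e)) N \<longleftrightarrow> factor A B E a b N"
    and rebase_arc_system: "arc_system A E a (\<lambda>e. g (b e)) M"
proof -
  have Mb: "bij_betw b M B" and Ma: "bij_betw a M A" and ME: "M \<subseteq> E"
    using M by (auto simp: factor_def)
  have g: "bij_betw g B A"
    using bij_betw_trans[OF bij_betw_inv_into[OF Mb] Ma] by (simp add: g_def comp_def)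
  have eq: "factor A A E a (\<lambda>e. g (b e)) N \<longleftrightarrow> factor A B E a b N" for N
  proof (cases "N \<subseteq> E")
    case True
    then have "b ` N \<subseteq> B" using b_in by auto
    then show ?thesis
      using bij_betw_comp_iff2[OF g, of b N] by (simp add: factor_def comp_def)
  qed (simp add: factor_def)
  show "factor A A E a (\<lambda>e. g (b e)) N \<longleftrightarrow> factor A B E a b N" by (rule eq)
  show "arc_system A E a (\<lambda>e. g (b e)) M"
  proof
    show "g (b e) \<in> A" if "e \<in> E" for e using b_in[OF that] g by (auto dest: bij_betwE)
    show "\<exists>N. factor A A E a (\<lambda>e. g (b e)) N \<and> e \<in> N" if "e \<in> E" for e
      using covered[OF that] eq by auto
    show "S = A" if "S \<subseteq> A" "T \<subseteq> A" "S \<noteq> {}"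
      and st: "\<And>e. e \<in> E \<Longrightarrow> a e \<in> S \<longleftrightarrow> g (b e) \<in> T" for S T
      using that(1,3) st b_in by (intro connected[of S "{y \<in> B. g y \<in> T}"]) auto
    show "factor A A E a (\<lambda>e. g (b e)) M" using M eq by simp
    show "g (b e) = a e" if "e \<in> M" for e
      using that Mb by (simp add: g_def bij_betw_inv_into_left)
  qed (use finite_A finite_E A_nonempty a_in in auto)
qed

lemma bij_betw_inj_on_same: "bij_betw f N V \<Longrightarrow> x \<in> N \<Longrightarrow> y \<in> N \<Longrightarrow> f x = f y \<Longrightarrow> x = y"
  by (auto simp: bij_betw_def dest: inj_onD)

context arc_system
begin

abbreviation "fac \<equiv> factor V V E t h"

abbreviation "num e \<equiv> card {N. fac N \<and> e \<in> N}"

text \<open>Disjoint cycles are encoded by injectivity and a common set of tails and heads, without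
  walks or an order on the arcs. The empty set qualifies, and so does a single loop outside
  \<open>M\<close>.\<close>

definition circ :: "'e set \<Rightarrow> bool" where
  "circ K \<longleftrightarrow> K \<subseteq> E - M \<and> inj_on t K \<and> inj_on h K \<and> t ` K = h ` K"

definition complete :: "'e set \<Rightarrow> 'e set" where
  "complete K = K \<union> {m \<in> M. t m \<notin> t ` K}"

lemma M_sub: "M \<subseteq> E" and M_t: "bij_betw t M V"
  using M_factor by (auto simp: factor_def)

text \<open>Reversal of all arcs, used for in-degrees. Only the cut condition needs work, as
  \<open>S\<close> and \<open>T\<close> trade roles; the loops of \<open>M\<close> force them to be
  equal.\<close>

lemma dual: "arc_system V E h t M"
proof
  show "\<exists>N. factor V V E h t N \<and> e \<in> N" if "e \<in> E" for e
    using covered[OF that] by (auto simp: factor_def)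
  show "S = V" if "S \<subseteq> V" "T \<subseteq> V" "S \<noteq> {}" "\<And>e. e \<in> E \<Longrightarrow> h e \<in> S \<longleftrightarrow> t e \<in> T" for S T
  proof -
    have "T = S"
    proof -
      have "v \<in> T \<longleftrightarrow> v \<in> S" if "v \<in> V" for v
      proof -
        obtain m where "m \<in> M" "t m = v" using M_t \<open>v \<in> V\<close> by (auto simp: bij_betw_def)
        then show ?thesis using that M_loops M_sub \<open>\<And>e. e \<in> E \<Longrightarrow> h e \<in> S \<longleftrightarrow> t e \<in> T\<close>[of m] by auto
      qed
      with \<open>S \<subseteq> V\<close> \<open>T \<subseteq> V\<close> show ?thesis by auto
    qed
    then show ?thesis using that connected[of S S] by auto
  qed
  show "factor V V E h t M" using M_factor by (simp add: factor_def)
qed (use finite_A finite_E A_nonempty a_in b_in M_loops in auto)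

lemma circ_finite: "circ K \<Longrightarrow> finite K"
  using finite_E by (meson circ_def finite_Diff finite_subset)

lemma circ_tails: "circ K \<Longrightarrow> t ` K \<subseteq> V"
  using a_in by (force simp: circ_def)

lemma finite_facs: "finite {N. fac N}"
  by (rule finite_subset[of _ "Pow E"]) (auto simp: factor_def finite_E)

lemma finite_facs': "finite {N. fac N \<and> P N}"
  by (rule finite_subset[OF _ finite_facs]) auto

lemma fac_edge: "fac N \<Longrightarrow> v \<in> V \<Longrightarrow> \<exists>e\<in>N. t e = v"
  by (auto simp: factor_def bij_betw_def)

lemma fac_subset_eq: "fac N \<Longrightarrow> fac N' \<Longrightarrow> N \<subseteq> N' \<Longrightarrow> N = N'"
  by (metis factor_def card_subset_eq bij_betw_same_card finite_E finite_subset)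

lemma circ_complete:
  assumes "circ K"
  shows "fac (complete K)" "complete K - M = K"
proof -
  note K = assms[unfolded circ_def]
  let ?R = "{m \<in> M. t m \<notin> t ` K}"
  have R: "bij_betw t ?R (V - t ` K)"
    using M_t by (fastforce simp: bij_betw_def inj_on_def)
  have R': "bij_betw h ?R (V - t ` K)"
    using R by (rule bij_betw_cong[THEN iffD1, rotated]) (simp add: M_loops)
  have Kt: "bij_betw t K (t ` K)" and Kh: "bij_betw h K (t ` K)"
    using K by (auto simp: bij_betw_def)
  have V: "t ` K \<union> (V - t ` K) = V" using circ_tails[OF assms] by auto
  have "bij_betw t (K \<union> ?R) V"
    using bij_betw_combine[OF Kt R] V by auto
  moreover have "bij_betw h (K \<union> ?R) V"
    using bij_betw_combine[OF Kh R'] V by auto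
  ultimately show "fac (complete K)"
    using K M_sub by (auto simp: factor_def complete_def)
  show "complete K - M = K" using K by (auto simp: complete_def)
qed

text \<open>Dropping the loops in \<open>N \<inter> M\<close> removes the same vertices from the
  tails and from the heads of \<open>N\<close>, so the rest stays balanced.\<close>

lemma fac_diff_circ:
  assumes "fac N"
  shows "circ (N - M)" "complete (N - M) = N"
proof -
  have N: "N \<subseteq> E" "bij_betw t N V" "bij_betw h N V" using assms by (auto simp: factor_def)
  have img: "f ` (N - M) = V - t ` (N \<inter> M)" if "bij_betw f N V" "\<And>e. e \<in> M \<Longrightarrow> f e = t e" for f
  proof -
    have "f ` (N - M) = f ` N - f ` (N \<inter> M)"
      using that(1) by (auto simp: bij_betw_def inj_on_def)
    also have "f ` (N \<inter> M) = t ` (N \<inter> M)" using that(2) by (intro image_cong) auto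
    finally show ?thesis using that(1) by (simp add: bij_betw_def)
  qed
  have tN: "t ` (N - M) = V - t ` (N \<inter> M)" and hN: "h ` (N - M) = V - t ` (N \<inter> M)"
    using img N M_loops by auto
  show "circ (N - M)"
    using N tN hN by (auto simp: circ_def bij_betw_def intro: inj_on_subset)
  have "m \<in> N" if "m \<in> M" "t m \<notin> t ` (N - M)" for m
  proof -
    have "t m \<in> t ` (N \<inter> M)" using that tN M_t by (auto simp: bij_betw_def)
    then show ?thesis using that M_t by (auto simp: bij_betw_def inj_on_def)
  qed
  moreover have "t m \<notin> t ` (N - M)" if "m \<in> N" "m \<in> M" for m
    using that tN by auto
  ultimately show "complete (N - M) = N" by (auto simp: complete_def)
qed

text \<open>Under the bijection between factors and circs, containing the loop \<open>m\<close>
  means avoiding its vertex. The empty circ, that is \<open>M\<close>, is counted too.\<close>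

lemma num_M:
  assumes "m \<in> M"
  shows "num m = card {K. circ K \<and> t m \<notin> t ` K}"
proof (rule bij_betw_same_card[of "\<lambda>N. N - M"])
  show "bij_betw (\<lambda>N. N - M) {N. fac N \<and> m \<in> N} {K. circ K \<and> t m \<notin> t ` K}"
  proof (rule bij_betw_byWitness[where f' = complete])
    show "(\<lambda>N. N - M) ` {N. fac N \<and> m \<in> N} \<subseteq> {K. circ K \<and> t m \<notin> t ` K}"
    proof clarify
      fix N assume N: "fac N" "m \<in> N"
      have "t m \<notin> t ` (N - M)"
      proof
        assume "t m \<in> t ` (N - M)"
        then obtain x where "x \<in> N - M" "t x = t m" by (metis imageE)
        then show False using N assms by (metis DiffE factor_def bij_betw_def inj_onD)
      qed
      then show "circ (N - M) \<and> t m \<notin> t ` (N - M)" using fac_diff_circ[OF N(1)] by blast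
    qed
    show "complete ` {K. circ K \<and> t m \<notin> t ` K} \<subseteq> {N. fac N \<and> m \<in> N}"
      using circ_complete assms by (auto simp: complete_def)
  qed (use fac_diff_circ circ_complete in auto)
qed

lemma num_arc:
  assumes "e \<in> E - M"
  shows "num e = card {K. circ K \<and> e \<in> K}"
proof (rule bij_betw_same_card[of "\<lambda>N. N - M"])
  show "bij_betw (\<lambda>N. N - M) {N. fac N \<and> e \<in> N} {K. circ K \<and> e \<in> K}"
  proof (rule bij_betw_byWitness[where f' = complete])
    show "(\<lambda>N. N - M) ` {N. fac N \<and> e \<in> N} \<subseteq> {K. circ K \<and> e \<in> K}"
      using fac_diff_circ assms by auto
    show "complete ` {K. circ K \<and> e \<in> K} \<subseteq> {N. fac N \<and> e \<in> N}"
      using circ_complete by (auto simp: complete_def)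
  qed (use fac_diff_circ circ_complete in auto)
qed

lemma finite_circs: "finite {K. circ K \<and> P K}"
  by (rule finite_subset[of _ "Pow E"]) (auto simp: circ_def finite_E)

text \<open>Strong connectivity. In a factor through an arc with head in \<open>S\<close>, the arcs
  with tail in \<open>S\<close> have distinct heads in \<open>S\<close> and are as many as its
  vertices. They use up all heads in \<open>S\<close>, so no arc enters \<open>S\<close> from
  outside, and the cut condition applies.\<close>

lemma closed_imp_all:
  assumes S: "S \<subseteq> V" "S \<noteq> {}" and cl: "\<And>e. e \<in> E - M \<Longrightarrow> t e \<in> S \<Longrightarrow> h e \<in> S"
  shows "S = V"
proof (rule connected[OF S(1) S])
  have cl': "h e \<in> S" if "e \<in> E" "t e \<in> S" for e
    using cl[of e] M_loops[of e] that by (cases "e \<in> M") auto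
  fix e assume e: "e \<in> E"
  have "t e \<in> S" if "h e \<in> S"
  proof -
    obtain N where N: "fac N" "e \<in> N" using covered[OF e] by auto
    let ?X = "{x \<in> N. t x \<in> S}"
    have X: "bij_betw t ?X S"
      unfolding bij_betw_def
    proof
      show "inj_on t ?X" using N by (auto simp: factor_def bij_betw_def intro: inj_on_subset)
      show "t ` ?X = S" using N S fac_edge by blast
    qed
    have hX: "inj_on h ?X" using N by (auto simp: factor_def bij_betw_def inj_on_def)
    have "h ` ?X = S"
    proof (rule card_subset_eq)
      show "finite S" using S finite_A finite_subset by auto
      show "h ` ?X \<subseteq> S" using cl' N by (auto simp: factor_def)
      show "card (h ` ?X) = card S" using card_image[OF hX] bij_betw_same_card[OF X] by simp
    qed
    then have "h e \<in> h ` ?X" using that by simp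
    then obtain x where "x \<in> ?X" "h x = h e" by (rule imageE) auto
    moreover then have "x = e" using N bij_betw_inj_on_same[of h N V x e] by (auto simp: factor_def)
    ultimately show ?thesis by auto
  qed
  then show "t e \<in> S \<longleftrightarrow> h e \<in> S" using cl' e by auto
qed

definition arcs :: "'e set \<Rightarrow> ('v \<times> 'v) set" where
  "arcs P = (\<lambda>e. (t e, h e)) ` P"

lemma arcs_mono: "P \<subseteq> Q \<Longrightarrow> arcs P \<subseteq> arcs Q"
  by (auto simp: arcs_def)

text \<open>A shortest walk repeats no vertex, so \<open>e\<close> closes it to a directed
  cycle.\<close>

lemma circ_from_walk:
  assumes e: "e \<in> E - M" and P: "P \<subseteq> E - M" and walk: "(h e, t e) \<in> (arcs P)\<^sup>*"
  obtains K where "circ K" "e \<in> K" "K \<subseteq> insert e P"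
proof -
  define k where "k = (LEAST k. (h e, t e) \<in> arcs P ^^ k)"
  have k: "(h e, t e) \<in> arcs P ^^ k"
    unfolding k_def by (rule LeastI_ex) (use walk rtrancl_imp_relpow in blast)
  have min: "k \<le> j" if "(h e, t e) \<in> arcs P ^^ j" for j
    unfolding k_def using that by (rule Least_le)
  obtain p where p: "p 0 = h e" "p k = t e" and step: "\<And>i. i < k \<Longrightarrow> (p i, p (Suc i)) \<in> arcs P"
    using k by (auto simp: relpow_fun_conv)
  have seg: "(p i, p (i + d)) \<in> arcs P ^^ d" if "i + d \<le> k" for i d
    using that step by (auto simp: relpow_fun_conv intro!: exI[of _ "\<lambda>j. p (i + j)"])
  have "p i \<noteq> p j" if "i < j" "j \<le> k" for i j
  proof
    assume eq: "p i = p j"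
    have "(p 0, p i) \<in> arcs P ^^ i" using seg[of 0 i] that by auto
    moreover have "(p j, p k) \<in> arcs P ^^ (k - j)" using seg[of j "k - j"] that by auto
    ultimately have "(h e, t e) \<in> arcs P ^^ (i + (k - j))" using eq p by (auto simp: relpow_add)
    from min[OF this] that show False by auto
  qed
  then have inj: "inj_on p {..k}" by (intro linorder_inj_onI) auto
  have "\<forall>i. \<exists>f. i < k \<longrightarrow> f \<in> P \<and> t f = p i \<and> h f = p (Suc i)"
    using step by (fastforce simp: arcs_def)
  then obtain f where f: "\<And>i. i < k \<Longrightarrow> f i \<in> P \<and> t (f i) = p i \<and> h (f i) = p (Suc i)" by metis
  \<comment> \<open>\<open>F\<close> lists the arcs of the cycle with \<open>e\<close> in the last
    position \<open>k\<close>, and \<open>s\<close> is the cyclic successor of a position. For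
    \<open>k = 0\<close> the cycle is the loop \<open>e\<close>.\<close>
  define F where "F i = (if i = k then e else f i)" for i
  define s where "s i = (if i = k then 0 else Suc i)" for i
  have Ft: "t (F i) = p i" and Fh: "h (F i) = p (s i)" if "i \<in> {..k}" for i
    using f that p by (auto simp: F_def s_def)
  have FP: "F ` {..k} \<subseteq> insert e P"
  proof clarify
    fix i assume "i \<le> k" "F i \<notin> P"
    then show "F i = e" using f[of i] by (cases "i = k") (auto simp: F_def)
  qed
  have s: "s ` {..k} = {..k}"
  proof -
    have "i \<in> s ` {..k}" if "i \<le> k" for i
    proof (cases i)
      case 0
      then have "i = s k" by (simp add: s_def)
      then show ?thesis by blast
    next
      case (Suc j)
      then have "i = s j" "j \<le> k" using that by (auto simp: s_def)
      then show ?thesis by blast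
    qed
    moreover have "s i \<le> k" if "i \<le> k" for i using that by (simp add: s_def)
    ultimately show ?thesis by blast
  qed
  have s_inj: "inj_on s {..k}" by (auto simp: inj_on_def s_def split: if_splits)
  have "circ (F ` {..k})"
    unfolding circ_def
  proof (intro conjI)
    show "F ` {..k} \<subseteq> E - M" using FP e P by blast
    show "inj_on t (F ` {..k})" using inj Ft by (auto simp: inj_on_def)
    have "inj_on (\<lambda>i. p (s i)) {..k}"
      using comp_inj_on[OF s_inj] inj s by (simp add: comp_def)
    then show "inj_on h (F ` {..k})" using Fh by (auto simp: inj_on_def)
    have "t ` F ` {..k} = p ` {..k}" by (auto simp: image_image Ft)
    moreover have "h ` F ` {..k} = p ` s ` {..k}" by (auto simp: image_image Fh)
    ultimately show "t ` F ` {..k} = h ` F ` {..k}" using s by simp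
  qed
  moreover have "e \<in> F ` {..k}" by (auto simp: F_def)
  ultimately show ?thesis using that FP by blast
qed

text \<open>A finite acyclic relation is well-founded, and a minimal element of \<open>S\<close>
  would have no predecessor in \<open>S\<close>.\<close>

lemma circ_from_predecessors:
  assumes P: "P \<subseteq> E - M" and S: "S \<noteq> {}" and pre: "\<And>s. s \<in> S \<Longrightarrow> \<exists>e\<in>P. h e = s \<and> t e \<in> S"
  obtains K where "circ K" "K \<noteq> {}" "K \<subseteq> P"
proof -
  have fin: "finite (arcs P)" using P finite_E by (auto simp: arcs_def intro: finite_subset)
  have "\<not> acyclic (arcs P)"
  proof
    assume "acyclic (arcs P)"
    then have "wf (arcs P)" using fin finite_acyclic_wf by auto
    moreover obtain s0 where "s0 \<in> S" using S by auto
    ultimately obtain s where "s \<in> S" "\<And>y. (y, s) \<in> arcs P \<Longrightarrow> y \<notin> S"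
      by (meson wfE_min)
    then show False using pre[of s] by (force simp: arcs_def)
  qed
  then obtain x where "(x, x) \<in> (arcs P)\<^sup>+" by (auto simp: acyclic_def)
  then obtain y where "(x, y) \<in> arcs P" "(y, x) \<in> (arcs P)\<^sup>*" by (meson tranclD)
  then obtain e where "e \<in> P" "(h e, t e) \<in> (arcs P)\<^sup>*" by (auto simp: arcs_def)
  moreover then obtain K where "circ K" "e \<in> K" "K \<subseteq> insert e P"
    using circ_from_walk[of e P] P by blast
  ultimately show ?thesis using that[of K] by auto
qed

text \<open>The arcs of \<open>K\<close> whose tails are reachable from \<open>x\<close> have heads
  reachable from \<open>x\<close> as well. Injectivity on a finite set makes them a circ, which by
  minimality is all of \<open>K\<close>.\<close>

lemma minimal_circ_reach:
  assumes K: "circ K" and min: "\<And>L. circ L \<Longrightarrow> L \<noteq> {} \<Longrightarrow> L \<subseteq> K \<Longrightarrow> L = K"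
    and x: "x \<in> t ` K" and y: "y \<in> t ` K"
  shows "(x, y) \<in> (arcs K)\<^sup>*"
proof -
  define S where "S = {z \<in> t ` K. (x, z) \<in> (arcs K)\<^sup>*}"
  define L where "L = {e \<in> K. t e \<in> S}"
  have tL: "t ` L = S" by (auto simp: L_def S_def)
  have "h ` L \<subseteq> S"
  proof -
    have "h e \<in> t ` K" if "e \<in> K" for e using K that by (auto simp: circ_def)
    moreover have "(t e, h e) \<in> arcs K" if "e \<in> K" for e using that by (auto simp: arcs_def)
    ultimately show ?thesis by (auto simp: L_def S_def intro: rtrancl_into_rtrancl)
  qed
  moreover have injL: "inj_on t L" "inj_on h L"
    using K by (auto simp: circ_def L_def intro: inj_on_subset)
  moreover have "finite S" using circ_finite[OF K] by (auto simp: S_def)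
  ultimately have "h ` L = S" using tL by (metis card_image card_subset_eq)
  then have "circ L" using K injL tL by (auto simp: circ_def L_def)
  moreover have "L \<noteq> {}" using x tL by (auto simp: S_def)
  ultimately have "L = K" using min by (auto simp: L_def)
  then show ?thesis using y tL by (auto simp: S_def)
qed

end

subsection \<open>All edges in two perfect matchings\<close>

locale two_system = arc_system +
  assumes two: "e \<in> E \<Longrightarrow> num e = 2"
begin

text \<open>Of the two factors through the loop of \<open>M\<close> at \<open>v\<close>, one is
  \<open>M\<close>, the empty circ; the other is the circ sought.\<close>

lemma avoid_ex1:
  assumes "v \<in> V"
  shows "\<exists>!K. circ K \<and> K \<noteq> {} \<and> v \<notin> t ` K"
proof -
  obtain m where m: "m \<in> M" "t m = v" using M_t assms by (auto simp: bij_betw_def)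
  let ?A = "{K. circ K \<and> v \<notin> t ` K}"
  have "card ?A = 2" using num_M[OF m(1)] two[of m] m M_sub by auto
  moreover have "{} \<in> ?A" by (auto simp: circ_def)
  ultimately have "card (?A - {{}}) = 1" by simp
  then obtain K where "?A - {{}} = {K}" by (rule card_1_singletonE)
  then have "circ L \<and> L \<noteq> {} \<and> v \<notin> t ` L \<longleftrightarrow> L = K" for L by blast
  then show ?thesis by simp
qed

lemma avoid_unique:
  "v \<in> V \<Longrightarrow> circ K \<Longrightarrow> K \<noteq> {} \<Longrightarrow> v \<notin> t ` K \<Longrightarrow> circ L \<Longrightarrow> L \<noteq> {} \<Longrightarrow> v \<notin> t ` L \<Longrightarrow> K = L"
  using avoid_ex1[of v] by blast

lemma arc_in_two:
  assumes "circ J" "circ K" "circ L" "e \<in> J" "e \<in> K" "e \<in> L" "K \<noteq> L"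
  shows "J = K \<or> J = L"
proof (rule ccontr)
  assume "\<not> ?thesis"
  then have "card {J, K, L} = 3" using assms(7) by auto
  moreover have "card {J, K, L} \<le> card {K. circ K \<and> e \<in> K}"
    by (rule card_mono[OF finite_circs]) (use assms in auto)
  moreover have "e \<in> E - M" using assms by (auto simp: circ_def)
  ultimately show False using num_arc[of e] two[of e] by auto
qed

lemma no_disjoint_circs:
  assumes n: "card V \<ge> 3" and K: "circ K" "K \<noteq> {}" and K': "circ K'" "K' \<noteq> {}"
  shows "t ` K \<inter> t ` K' \<noteq> {}"
proof
  assume disj: "t ` K \<inter> t ` K' = {}"
  note KV = circ_tails[OF K(1)] circ_tails[OF K'(1)]
  have un: "circ (K \<union> K')"
  proof -
    have hd: "h ` K \<inter> h ` K' = {}" using disj K(1) K'(1) by (simp add: circ_def)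
    have "inj_on f (K \<union> K')" if "inj_on f K" "inj_on f K'" "f ` K \<inter> f ` K' = {}" for f :: "'b \<Rightarrow> 'a"
      using that unfolding inj_on_Un by blast
    from this[of t] this[of h] show ?thesis
      using K(1) K'(1) disj hd by (simp add: circ_def image_Un)
  qed
  have "K \<inter> K' = {}" using disj by auto
  with K K' have ne: "K \<noteq> K \<union> K'" "K' \<noteq> K \<union> K'" by auto
  \<comment> \<open>A vertex outside the union would be avoided both by \<open>K\<close> and by the
    larger circ \<open>K \<union> K'\<close>.\<close>
  have V: "V = t ` K \<union> t ` K'"
  proof -
    have "v \<in> t ` K \<union> t ` K'" if "v \<in> V" for v
      using avoid_unique[OF that K _ un] ne K by (auto simp: image_Un)
    then show ?thesis using KV by auto
  qed
  \<comment> \<open>An arc of \<open>K\<close> is already in \<open>K\<close> and in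
    \<open>K \<union> K'\<close>, which uses up its two factors; likewise for
    \<open>K'\<close>.\<close>
  have onlyK: "J = K \<or> J = K \<union> K'" if "circ J" "e \<in> J" "e \<in> K" for J e
    using arc_in_two[OF that(1) K(1) un that(2,3)] that ne by auto
  have onlyK': "J = K' \<or> J = K \<union> K'" if "circ J" "e \<in> J" "e \<in> K'" for J e
    using arc_in_two[OF that(1) K'(1) un that(2,3)] that ne by auto
  obtain x x' where x: "x \<in> t ` K" and x': "x' \<in> t ` K'" using K(2) K'(2) by auto
  have minK: "L = K" if "circ L" "L \<noteq> {}" "L \<subseteq> K" for L
    using that K disj x' KV by (intro avoid_unique[of x']) auto
  have minK': "L = K'" if "circ L" "L \<noteq> {}" "L \<subseteq> K'" for L
    using that K' disj x KV by (intro avoid_unique[of x]) auto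
  have "t ` K \<noteq> V" "t ` K' \<noteq> V" using x x' disj KV by blast+
  obtain a where a: "a \<in> E - M" "t a \<in> t ` K" "h a \<notin> t ` K"
    using closed_imp_all[OF KV(1)] \<open>t ` K \<noteq> V\<close> K(2) by blast
  obtain b where b: "b \<in> E - M" "t b \<in> t ` K'" "h b \<notin> t ` K'"
    using closed_imp_all[OF KV(2)] \<open>t ` K' \<noteq> V\<close> K'(2) by blast
  have ha: "h a \<in> t ` K'" and hb: "h b \<in> t ` K" using a b b_in V by auto
  \<comment> \<open>The closed walk leaves \<open>K\<close> by \<open>a\<close>, follows
    \<open>K'\<close> to the tail of \<open>b\<close>, returns by \<open>b\<close> and follows
    \<open>K\<close> to the tail of \<open>a\<close>. Minimality of \<open>K\<close> and
    \<open>K'\<close> provides the stretches inside them.\<close>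
  let ?P = "insert b (K \<union> K')"
  have "(h a, t b) \<in> (arcs ?P)\<^sup>*"
    using minimal_circ_reach[OF K'(1) minK' ha b(2)] rtrancl_mono[OF arcs_mono[of K' ?P]] by blast
  moreover have "(t b, h b) \<in> arcs ?P" by (auto simp: arcs_def)
  moreover have "(h b, t a) \<in> (arcs ?P)\<^sup>*"
    using minimal_circ_reach[OF K(1) minK hb a(2)] rtrancl_mono[OF arcs_mono[of K ?P]] by blast
  ultimately have "(h a, t a) \<in> (arcs ?P)\<^sup>*"
    by (meson rtrancl_into_rtrancl rtrancl_trans)
  moreover have "?P \<subseteq> E - M" using b K K' by (auto simp: circ_def)
  ultimately obtain L where L: "circ L" "a \<in> L" "L \<subseteq> insert a ?P"
    using circ_from_walk[OF a(1)] by blast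
  have "a \<notin> K" using a K by (auto simp: circ_def)
  moreover have "a \<notin> K'" using a disj by auto
  ultimately have Lne: "L \<noteq> K" "L \<noteq> K'" "L \<noteq> K \<union> K'" using L(2) by auto
  \<comment> \<open>Only \<open>K\<close>, \<open>K'\<close> and their union can use an arc of
    \<open>K\<close> or \<open>K'\<close>, and \<open>L\<close> is none of these because it contains
    \<open>a\<close>.\<close>
  have "L \<subseteq> {a, b}" using onlyK[OF L(1)] onlyK'[OF L(1)] Lne L(3) by blast
  \<comment> \<open>Here \<open>card V \<ge> 3\<close> enters: \<open>L\<close> avoids a third
    vertex, and so does one of \<open>K\<close> and \<open>K'\<close>, contrary to
    uniqueness.\<close>
  have "\<not> V \<subseteq> {t a, t b}"
  proof
    assume "V \<subseteq> {t a, t b}"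
    then have "card V \<le> card {t a, t b}" by (intro card_mono) auto
    also have "\<dots> \<le> 2" by (simp add: card_insert_if)
    finally show False using n by simp
  qed
  then obtain v where v: "v \<in> V" "v \<notin> {t a, t b}" by auto
  then have "v \<notin> t ` L" using \<open>L \<subseteq> {a, b}\<close> by auto
  moreover have "L \<noteq> {}" using L by auto
  ultimately show False
    using avoid_unique[OF v(1) L(1) _ _ K] avoid_unique[OF v(1) L(1) _ _ K'] disj v V Lne by blast
qed

text \<open>A loop outside \<open>M\<close> is a circ by itself, disjoint from the circ that avoids
  its vertex.\<close>

lemma no_loops:
  assumes n: "card V \<ge> 3" and e: "e \<in> E - M"
  shows "t e \<noteq> h e"
proof
  assume loop: "t e = h e"
  then have "circ {e}" using e by (auto simp: circ_def)
  moreover obtain K where "circ K" "K \<noteq> {}" "t e \<notin> t ` K"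
    using avoid_ex1[of "t e"] a_in[of e] e by blast
  ultimately show False using no_disjoint_circs[OF n, of K "{e}"] by auto
qed

text \<open>If a factor through \<open>e\<close> is contracted instead of \<open>M\<close>, a
  parallel arc \<open>f\<close> becomes a loop outside the contracted matching.\<close>

lemma no_parallel:
  assumes n: "card V \<ge> 3" and e: "e \<in> E" and f: "f \<in> E" and eq: "t e = t f" "h e = h f"
  shows "e = f"
proof (rule ccontr)
  assume "e \<noteq> f"
  obtain N where N: "fac N" "e \<in> N" using covered[OF e] by auto
  define g where "g y = t (inv_into N h y)" for y
  have fac_eq: "factor V V E t (\<lambda>e. g (h e)) X \<longleftrightarrow> fac X" for X
    unfolding g_def by (rule rebase_factor[OF N(1)])
  interpret R: two_system V E t "\<lambda>e. g (h e)" N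
  proof (intro two_system.intro two_system_axioms.intro)
    show "arc_system V E t (\<lambda>e. g (h e)) N"
      unfolding g_def by (rule rebase_arc_system[OF N(1)])
    show "card {X. factor V V E t (\<lambda>e. g (h e)) X \<and> e \<in> X} = 2" if "e \<in> E" for e
      using two[OF that] fac_eq by simp
  qed
  have "f \<notin> N" using N \<open>e \<noteq> f\<close> eq by (auto simp: factor_def bij_betw_def dest: inj_onD)
  then have "t f \<noteq> g (h f)" using R.no_loops n f by auto
  then show False using R.M_loops[OF N(2)] eq by simp
qed

lemma dual_two: "two_system V E h t M"
proof (intro two_system.intro two_system_axioms.intro dual)
  show "card {N. factor V V E h t N \<and> e \<in> N} = 2" if "e \<in> E" for e
  proof -
    have "{N. factor V V E h t N \<and> e \<in> N} = {N. fac N \<and> e \<in> N}" by (auto simp: factor_def)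
    then show ?thesis using two[OF that] by simp
  qed
qed

text \<open>Every factor uses exactly one edge with tail \<open>v\<close>, and every such edge is in
  two factors. The right-hand side does not depend on \<open>v\<close>, which is the regularity
  needed later.\<close>

lemma degree:
  assumes v: "v \<in> V"
  shows "2 * card {e \<in> E. t e = v} = card {N. fac N}"
proof -
  let ?D = "{e \<in> E. t e = v}"
  have "{N. fac N} = (\<Union>e\<in>?D. {N. fac N \<and> e \<in> N})"
  proof -
    have "\<exists>e\<in>?D. e \<in> N" if "fac N" for N
      using fac_edge[OF that v] that by (auto simp: factor_def)
    then show ?thesis by blast
  qed
  also have "card \<dots> = (\<Sum>e\<in>?D. num e)"
  proof (rule card_UN_disjoint)
    show "finite ?D" using finite_E by simp
    show "\<forall>e\<in>?D. finite {N. fac N \<and> e \<in> N}" using finite_facs' by blast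
    show "\<forall>e\<in>?D. \<forall>f\<in>?D. e \<noteq> f \<longrightarrow> {N. fac N \<and> e \<in> N} \<inter> {N. fac N \<and> f \<in> N} = {}"
      by (auto simp: factor_def bij_betw_def dest: inj_onD)
  qed
  also have "\<dots> = 2 * card ?D" using two by simp
  finally show ?thesis by simp
qed

text \<open>\<open>Suc\<close> accounts for the loop of \<open>M\<close> at \<open>v\<close>, which
  \<open>degree\<close> counts as well.\<close>

lemma out_degree:
  assumes v: "v \<in> V"
  shows "2 * Suc (card {e \<in> E - M. t e = v}) = card {N. fac N}"
proof -
  obtain m where m: "m \<in> M" "t m = v" using M_t v by (auto simp: bij_betw_def)
  have "{e \<in> E. t e = v} = insert m {e \<in> E - M. t e = v}"
  proof
    show "{e \<in> E. t e = v} \<subseteq> insert m {e \<in> E - M. t e = v}"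
      using m bij_betw_inj_on_same[OF M_t] by auto
  qed (use m M_sub in auto)
  then show ?thesis using degree[OF v] finite_E m by simp
qed

lemma in_degree:
  assumes v: "v \<in> V"
  shows "2 * Suc (card {e \<in> E - M. h e = v}) = card {N. fac N}"
proof -
  interpret D: two_system V E h t M by (rule dual_two)
  have "{N. factor V V E h t N} = {N. fac N}" by (auto simp: factor_def)
  then show ?thesis using D.out_degree[OF v] by simp
qed

text \<open>In terms of \<open>out_degree\<close>: at least two arcs outside \<open>M\<close> leave
  every vertex. With at most one, no arc could leave the circ that avoids \<open>v\<close>, against
  strong connectivity.\<close>

lemma many_facs: "card {N. fac N} \<ge> 6"
proof (rule ccontr)
  assume less: "\<not> ?thesis"
  obtain v where v: "v \<in> V" using A_nonempty by auto
  obtain C where C: "circ C" "C \<noteq> {}" "v \<notin> t ` C" using avoid_ex1[OF v] by blast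
  have "t ` C = V"
  proof (rule closed_imp_all[OF circ_tails[OF C(1)]])
    fix e assume e: "e \<in> E - M" "t e \<in> t ` C"
    then obtain c where c: "c \<in> C" "t c = t e" by auto
    let ?O = "{x \<in> E - M. t x = t e}"
    have "card ?O \<le> 1" using out_degree[of "t e"] a_in[of e] e(1) less by simp
    moreover have "finite ?O" using finite_E by simp
    moreover have "c \<in> E - M" using c(1) C(1) unfolding circ_def by (elim conjE subsetD)
    then have "c \<in> ?O" "e \<in> ?O" using c(2) e(1) by simp_all
    ultimately have "c = e" using card_le_Suc0_iff_eq[of ?O] by simp
    then show "h e \<in> t ` C" using c C by (auto simp: circ_def)
  qed (use C in auto)
  then show False using C v by simp
qed

text \<open>The count at the source \<open>s\<close> is tight: its in-degree is at least two by
  \<open>many_facs\<close>, and at most two, from \<open>f\<close> and from at most one arc leaving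
  \<open>v\<close>, as there are no parallel arcs. Equality gives \<open>s = h f\<close>, the arc
  from \<open>v\<close>, and via \<open>in_degree\<close> the number six.\<close>

lemma circ_from_vertex:
  assumes n: "card V \<ge> 3" and v: "v \<in> V" and C: "circ C" "v \<notin> t ` C" and f: "f \<in> C"
  shows "\<exists>e\<in>E - M. t e = v \<and> h e = h f" "card {N. fac N} = 6"
proof -
  define P where "P = {e \<in> E - M. t e \<noteq> v \<and> h e \<noteq> v \<and> e \<noteq> f}"
  \<comment> \<open>Without such a source \<open>P\<close> would contain a circ avoiding
    \<open>v\<close>. By uniqueness it would be \<open>C\<close>, but \<open>f\<close> is not in
    \<open>P\<close>.\<close>
  have "\<exists>s\<in>V - {v}. \<forall>e\<in>P. h e = s \<longrightarrow> t e \<notin> V - {v}"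
  proof (rule ccontr)
    assume "\<not> ?thesis"
    then have pre: "\<exists>e\<in>P. h e = s \<and> t e \<in> V - {v}" if "s \<in> V - {v}" for s using that by blast
    have "V \<noteq> {v}" using n by auto
    then have "V - {v} \<noteq> {}" using v by auto
    moreover have "P \<subseteq> E - M" by (auto simp: P_def)
    ultimately obtain K where K: "circ K" "K \<noteq> {}" "K \<subseteq> P"
      using circ_from_predecessors[of P "V - {v}"] pre by blast
    then have "v \<notin> t ` K" by (auto simp: P_def)
    then have "K = C" using avoid_unique[OF v K(1,2) _ C(1) _ C(2)] f by auto
    then show False using K f by (auto simp: P_def)
  qed
  then obtain s where s: "s \<in> V" "s \<noteq> v" and none: "\<And>e. e \<in> P \<Longrightarrow> h e \<noteq> s"
    using a_in by (auto simp: P_def)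
  define I where "I = {e \<in> E - M. h e = s}"
  define J where "J = {e \<in> E - M. t e = v \<and> h e = s}"
  have I: "2 * Suc (card I) = card {N. fac N}" unfolding I_def by (rule in_degree[OF s(1)])
  then have I2: "card I \<ge> 2" using many_facs by simp
  have fin: "finite I" "finite J" using finite_E by (auto simp: I_def J_def)
  have J1: "card J \<le> 1"
    using no_parallel[OF n] fin by (auto simp: J_def card_le_Suc0_iff_eq)
  have I_sub: "I \<subseteq> J \<union> ({f} \<inter> I)" using none s by (auto simp: I_def J_def P_def)
  have "card I \<le> card J + card ({f} \<inter> I)"
    using card_mono[OF _ I_sub] fin card_Un_le[of J "{f} \<inter> I"] by simp
  moreover have "card ({f} \<inter> I) \<le> 1" using card_mono[of "{f}" "{f} \<inter> I"] by simp
  ultimately have "card J = 1" "card ({f} \<inter> I) = 1" "card I = 2" using I2 J1 by linarith+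
  then have "J \<noteq> {}" "{f} \<inter> I \<noteq> {}" by (metis card.empty zero_neq_one)+
  then show "\<exists>e\<in>E - M. t e = v \<and> h e = h f" by (auto simp: I_def J_def)
  show "card {N. fac N} = 6" using I \<open>card I = 2\<close> by simp
qed

lemma circ_to_vertex:
  assumes n: "card V \<ge> 3" and v: "v \<in> V" and C: "circ C" "v \<notin> t ` C" and f: "f \<in> C"
  shows "\<exists>e\<in>E - M. h e = v \<and> t e = t f"
proof -
  interpret D: two_system V E h t M by (rule dual_two)
  have "D.circ C" "v \<notin> h ` C" using C by (auto simp: circ_def D.circ_def)
  then show ?thesis using D.circ_from_vertex(1)[OF n v _ _ f] by auto
qed

lemma card_V_le_3: "card V \<le> 3"
proof (rule ccontr)
  assume "\<not> ?thesis"
  then have n: "card V \<ge> 3" by simp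
  obtain v where v: "v \<in> V" using A_nonempty by auto
  obtain C where C: "circ C" "C \<noteq> {}" "v \<notin> t ` C" using avoid_ex1[OF v] by blast
  then obtain f where f: "f \<in> C" by auto
  have out: "card {e \<in> E - M. t e = u} = 2" if "u \<in> V" for u
    using out_degree[OF that] circ_from_vertex(2)[OF n v C(1,3) f] by simp
  let ?O = "{e \<in> E - M. t e = v}"
  have finO: "finite ?O" using finite_E by simp
  have hC: "t ` C = h ` C" using C by (auto simp: circ_def)
  \<comment> \<open>Each vertex of \<open>C\<close> is the head of some arc of \<open>C\<close>,
    hence also of an arc from \<open>v\<close>; only two arcs leave \<open>v\<close>, so
    \<open>C\<close> has at most two vertices.\<close>
  have sub: "t ` C \<subseteq> h ` ?O"
  proof
    fix x assume "x \<in> t ` C"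
    then have "x \<in> h ` C" by (simp only: hC)
    then obtain c where "c \<in> C" "h c = x" by (elim imageE) simp
    then obtain e where "e \<in> ?O" "x = h e" using circ_from_vertex(1)[OF n v C(1,3), of c] by auto
    then show "x \<in> h ` ?O" by (rule rev_image_eqI)
  qed
  have hO: "card (h ` ?O) \<le> 2" using card_image_le[OF finO, of h] out[OF v] by simp
  have "t f \<noteq> h f" using no_loops[OF n, of f] f C by (auto simp: circ_def)
  moreover have "{t f, h f} \<subseteq> t ` C" using f hC by auto
  ultimately have C2: "2 \<le> card (t ` C)"
    using card_mono[of "t ` C" "{t f, h f}"] circ_finite[OF C(1)] by simp
  then have eq: "t ` C = h ` ?O" using card_seteq[OF _ sub] finO hO by simp
  \<comment> \<open>No arc escapes: the arcs leaving \<open>v\<close> end in \<open>C\<close>, and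
    the two arcs leaving a vertex of \<open>C\<close> are its arc in \<open>C\<close> and an arc to
    \<open>v\<close>.\<close>
  have "insert v (t ` C) = V"
  proof (rule closed_imp_all)
    show "insert v (t ` C) \<subseteq> V" using v circ_tails[OF C(1)] by auto
    fix e assume e: "e \<in> E - M" "t e \<in> insert v (t ` C)"
    show "h e \<in> insert v (t ` C)"
    proof (cases "t e = v")
      case True
      then show ?thesis unfolding eq using e by auto
    next
      case False
      then obtain c where c: "c \<in> C" "t c = t e" using e by auto
      obtain d where d: "d \<in> E - M" "h d = v" "t d = t c"
        using circ_to_vertex[OF n v C(1,3) c(1)] by auto
      have "h c \<noteq> v" using c hC C by auto
      then have "c \<noteq> d" using d by metis
      then have "card {c, d} = 2" by simp
      moreover have "{c, d} \<subseteq> {x \<in> E - M. t x = t e}" using c d C by (auto simp: circ_def)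
      ultimately have "{c, d} = {x \<in> E - M. t x = t e}"
        using out[of "t e"] a_in[of e] e finite_E by (intro card_subset_eq) auto
      then have "e \<in> {c, d}" using e by auto
      then show ?thesis using d c hC by auto
    qed
  qed auto
  moreover have "card (insert v (t ` C)) \<le> Suc (card (t ` C))"
    using circ_finite[OF C(1)] by (simp add: card_insert_if)
  ultimately have "card V \<le> Suc (card (t ` C))" by simp
  moreover have "card (t ` C) \<le> 2" using hO eq by simp
  ultimately show False using \<open>\<not> card V \<le> 3\<close> by simp
qed

end

subsection \<open>A perfect matching of 1-matching edges\<close>

locale spanning_system = arc_system +
  assumes M_one: "m \<in> M \<Longrightarrow> num m = 1"
begin

text \<open>A nonempty circ avoiding a vertex would give a second factor, besides \<open>M\<close>,
  through the loop of \<open>M\<close> there.\<close>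

lemma spanning:
  assumes K: "circ K" "K \<noteq> {}"
  shows "t ` K = V"
proof (rule ccontr)
  assume "t ` K \<noteq> V"
  then obtain v where v: "v \<in> V" "v \<notin> t ` K" using circ_tails[OF K(1)] by auto
  obtain m where m: "m \<in> M" "t m = v" using M_t v by (auto simp: bij_betw_def)
  have "card {{}, K} \<le> card {K. circ K \<and> t m \<notin> t ` K}"
    by (rule card_mono[OF finite_circs]) (use K v m in \<open>auto simp: circ_def\<close>)
  then show False using num_M[OF m(1)] M_one[OF m(1)] K by simp
qed

lemma fac_disjoint_M:
  assumes N: "fac N" and e: "e \<in> N" "e \<notin> M"
  shows "N \<inter> M = {}"
proof (rule ccontr)
  assume "N \<inter> M \<noteq> {}"
  then obtain m where m: "m \<in> N" "m \<in> M" by auto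
  have "N - M \<noteq> {}" using e by auto
  then have "t ` (N - M) = V" using spanning fac_diff_circ[OF N] by blast
  then have "t m \<in> t ` (N - M)" using a_in m M_sub by auto
  then obtain x where x: "x \<in> N - M" "t m = t x" by auto
  then have "x = m" using N m by (auto simp: factor_def dest: bij_betw_inj_on_same)
  then show False using x m by simp
qed

lemma fac_circ:
  assumes N: "fac N" "N \<inter> M = {}"
  shows "circ N"
proof -
  have "N - M = N" using N(2) by auto
  then show ?thesis using fac_diff_circ(1)[OF N(1)] by simp
qed

text \<open>A nonempty circ inside \<open>N\<close> spans as well, so it is \<open>N\<close>. Hence
  \<open>N\<close> is minimal, a single Hamiltonian cycle.\<close>

lemma fac_reach:
  assumes N: "fac N" "N \<inter> M = {}" and "x \<in> V" "y \<in> V"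
  shows "(x, y) \<in> (arcs N)\<^sup>*"
proof (rule minimal_circ_reach[OF fac_circ[OF N]])
  show "L = N" if "circ L" "L \<noteq> {}" "L \<subseteq> N" for L
  proof -
    have L: "t ` L = V" by (rule spanning[OF that(1,2)])
    have "x \<in> L" if x: "x \<in> N" for x
    proof -
      have "t x \<in> t ` L" using L N x a_in by (auto simp: factor_def)
      then obtain y where "y \<in> L" "t x = t y" by auto
      then show ?thesis using N \<open>L \<subseteq> N\<close> x bij_betw_inj_on_same[of t N V x y] by (auto simp: factor_def)
    qed
    then show ?thesis using that(3) by auto
  qed
qed (use assms in \<open>auto simp: factor_def bij_betw_def\<close>)

text \<open>If \<open>e\<close> is not in \<open>K\<close>, it closes with a walk in
  \<open>K\<close> to a circ, which cannot contain \<open>k\<close>, as \<open>k\<close> and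
  \<open>e\<close> share their tail. The circ spans, so it has an arc into \<open>h k\<close>; in
  \<open>K\<close> only \<open>k\<close> enters there, so that arc is \<open>e\<close>.\<close>

lemma same_head:
  assumes K: "fac K" "K \<inter> M = {}" and e: "e \<in> E - M" and k: "k \<in> K" "t k = t e"
  shows "h e = h k"
proof (cases "e \<in> K")
  case True
  then have "k = e" using K k bij_betw_inj_on_same[of t K V k e] by (auto simp: factor_def)
  then show ?thesis by simp
next
  case False
  have "K \<subseteq> E - M" using K by (auto simp: factor_def)
  moreover have "(h e, t e) \<in> (arcs K)\<^sup>*" using fac_reach[OF K] a_in b_in e by auto
  ultimately obtain L where L: "circ L" "e \<in> L" "L \<subseteq> insert e K"
    using circ_from_walk[OF e] by blast
  have "h ` L = V" using spanning[of L] L by (auto simp: circ_def)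
  then have "h k \<in> h ` L" using b_in k K by (auto simp: factor_def)
  then obtain x where x: "x \<in> L" "h k = h x" by auto
  have "k \<notin> L"
  proof
    assume "k \<in> L"
    then have "k = e" using L k by (auto simp: circ_def dest: inj_onD)
    then show False using False k by simp
  qed
  moreover have "x = k" if "x \<in> K"
    using K k x that bij_betw_inj_on_same[of h K V x k] by (auto simp: factor_def)
  ultimately show ?thesis using x L by auto
qed

text \<open>By \<open>same_head\<close> the tail of an arc determines its head, so choosing one arc
  for every tail also hits every head once.\<close>

lemma fac_section:
  assumes K: "fac K" "K \<inter> M = {}" and N: "N \<subseteq> E - M" "bij_betw t N V"
  shows "fac N"
proof -
  let ?g = "h \<circ> inv_into K t"
  have Kt: "bij_betw t K V" and Kh: "bij_betw h K V" using K by (auto simp: factor_def)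
  have "h x = ?g (t x)" if "x \<in> N" for x
  proof -
    have "t x \<in> t ` K" using Kt N that a_in by (auto simp: bij_betw_def)
    then have "inv_into K t (t x) \<in> K" "t (inv_into K t (t x)) = t x"
      by (auto intro: inv_into_into f_inv_into_f)
    then show ?thesis using same_head[OF K, of x] N that by auto
  qed
  moreover have "bij_betw (?g \<circ> t) N V"
    by (rule bij_betw_trans[OF N(2) bij_betw_trans[OF bij_betw_inv_into[OF Kt] Kh]])
  ultimately have "bij_betw h N V" using bij_betw_cong[of N h "?g \<circ> t" V] by simp
  then show ?thesis using N by (auto simp: factor_def)
qed

lemma fac_exchange:
  assumes N: "fac N" "N \<inter> M = {}" and e: "e \<in> E - M"
  shows "fac (insert e {x \<in> N. t x \<noteq> t e})"
proof (rule fac_section[OF N])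
  have Nt: "inj_on t N" "t ` N = V" using N by (auto simp: factor_def bij_betw_def)
  show "insert e {x \<in> N. t x \<noteq> t e} \<subseteq> E - M" using N e by (auto simp: factor_def)
  have "inj_on t (insert e {x \<in> N. t x \<noteq> t e})"
    using Nt(1) by (auto simp: inj_on_def)
  moreover have "t ` (insert e {x \<in> N. t x \<noteq> t e}) = V"
    using Nt(2) a_in[of e] e by auto
  ultimately show "bij_betw t (insert e {x \<in> N. t x \<noteq> t e}) V" by (simp add: bij_betw_def)
qed

text \<open>Strong connectivity supplies an arc outside \<open>M\<close>. With one vertex there may
  be none, as \<open>M\<close> can be the whole graph.\<close>

lemma other_fac:
  assumes n: "card V \<ge> 2"
  obtains K where "fac K" "K \<inter> M = {}"
proof -
  obtain v where v: "v \<in> V" using A_nonempty by auto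
  have "{v} \<noteq> V" using n by auto
  then obtain e where e: "e \<in> E - M" using closed_imp_all[of "{v}"] v by blast
  then obtain K where "fac K" "e \<in> K" using covered by blast
  then show ?thesis using that fac_disjoint_M e by blast
qed

text \<open>By \<open>same_head\<close> all arcs outside \<open>M\<close> follow one successor map
  \<open>\<sigma>\<close>. Its orbit through \<open>v\<close> is all of \<open>V\<close>, since
  \<open>K\<close> is a Hamiltonian cycle, and \<open>p\<close> lists this orbit.\<close>

lemma cyclic_order:
  assumes n: "card V \<ge> 2"
  obtains p where "bij_betw p {..<card V} V"
    "\<And>e i. e \<in> E - M \<Longrightarrow> i < card V \<Longrightarrow> t e = p i \<Longrightarrow> h e = p (Suc i mod card V)"
proof -
  obtain K where K: "fac K" "K \<inter> M = {}" using other_fac[OF n] .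
  have Kt: "bij_betw t K V" and Kh: "bij_betw h K V" using K by (auto simp: factor_def)
  define \<sigma> where "\<sigma> v = h (inv_into K t v)" for v
  have \<sigma>_K: "\<sigma> (t k) = h k" if "k \<in> K" for k
    using Kt that by (simp add: \<sigma>_def bij_betw_inv_into_left)
  have K_ex: "\<exists>k\<in>K. t k = v" if "v \<in> V" for v using fac_edge[OF K(1) that] .
  have \<sigma>_V: "\<sigma> v \<in> V" if "v \<in> V" for v
    using K_ex[OF that] \<sigma>_K Kh by (auto simp: bij_betw_def)
  have \<sigma>: "h e = \<sigma> (t e)" if "e \<in> E - M" for e
    using K_ex[of "t e"] a_in[of e] that same_head[OF K that] \<sigma>_K by fastforce
  obtain v where v: "v \<in> V" using A_nonempty by auto
  have orb: "y \<in> orbit \<sigma> v" if "(\<sigma> v, y) \<in> (arcs K)\<^sup>*" for y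
    using that
  proof induction
    case base
    show ?case by (rule orbit.base)
  next
    case (step y z)
    then have "z = \<sigma> y" using \<sigma>_K by (auto simp: arcs_def)
    then show ?case using step.IH by (auto intro: orbit.step)
  qed
  have "y \<in> V" if "y \<in> orbit \<sigma> v" for y
    using that by induction (use v \<sigma>_V in auto)
  then have V: "orbit \<sigma> v = V" using orb fac_reach[OF K \<sigma>_V[OF v]] by blast
  then have vo: "v \<in> orbit \<sigma> v" using v by simp
  define p where "p i = (\<sigma> ^^ i) v" for i
  have p_eq: "p = (\<lambda>i. (\<sigma> ^^ i) v)" by (rule ext) (rule p_def)
  \<comment> \<open>The first positive number of steps that leads back to \<open>v\<close>, that is,
    the length of the orbit.\<close>
  define k where "k = funpow_dist1 \<sigma> v v"
  have img: "V = p ` {0..<k}"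
    using orbit_conv_funpow_dist1[OF vo] V by (simp add: p_eq k_def)
  have inj: "inj_on p {0..<k}"
    using inj_on_funpow_dist1[OF vo] by (simp add: p_eq k_def)
  have "card (p ` {0..<k}) = k" using card_image[OF inj] by simp
  then have k: "k = card V" by (simp only: img[symmetric])
  have "p k = v" unfolding p_def k_def by (rule funpow_dist1_prop[OF vo])
  then have pk: "p k = p 0" by (simp add: p_def)
  show ?thesis
  proof (rule that)
    show "bij_betw p {..<card V} V"
      unfolding k[symmetric] bij_betw_def lessThan_atLeast0
      using inj img[symmetric] by (rule conjI)
    fix e i assume e: "e \<in> E - M" "i < card V" "t e = p i"
    then have "h e = p (Suc i)" using \<sigma> by (simp add: p_def)
    then show "h e = p (Suc i mod card V)"
      using e(2) pk k by (cases "Suc i = card V") auto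
  qed
qed

end

locale one_two_system = spanning_system +
  assumes one_or_two: "e \<in> E \<Longrightarrow> num e = 1 \<or> num e = 2"
    and same_num: "fac N \<Longrightarrow> e \<in> N \<Longrightarrow> f \<in> N \<Longrightarrow> num e = num f"
begin

text \<open>Exchanging \<open>e\<close> for \<open>e'\<close> in \<open>N\<close> leaves another arc
  of \<open>N\<close> in two factors, and \<open>same_num\<close> carries the count two over to
  \<open>e\<close>. A second factor through \<open>e\<close> then offers an exchange in
  \<open>N\<close> at another vertex \<open>t g\<close>, and the arc of \<open>N\<close> at a third
  vertex lies in \<open>N\<close>, \<open>N'\<close> and \<open>N3\<close>.\<close>

lemma out_singleton:
  assumes n: "card V \<ge> 3" and e: "e \<in> E - M" and e': "e' \<in> E - M" and eq: "t e = t e'"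
  shows "e = e'"
proof (rule ccontr)
  assume ne: "e \<noteq> e'"
  obtain N where N: "fac N" "e \<in> N" using covered e by blast
  have NM: "N \<inter> M = {}" using fac_disjoint_M[OF N] e by auto
  have Nt: "bij_betw t N V" using N by (simp add: factor_def)
  define N' where "N' = insert e' {x \<in> N. t x \<noteq> t e'}"
  have N': "fac N'" unfolding N'_def by (rule fac_exchange[OF N(1) NM e'])
  have "e \<notin> N'" using ne eq by (auto simp: N'_def)
  have two: "num e = 2"
  proof -
    have "V \<noteq> {t e}" using n by auto
    then obtain w where w: "w \<in> V" "w \<noteq> t e" using A_nonempty by blast
    obtain f where f: "f \<in> N" "t f = w" using fac_edge[OF N(1) w(1)] by auto
    have "card {N, N'} \<le> num f"
      by (rule card_mono[OF finite_facs']) (use N N' f w eq in \<open>auto simp: N'_def\<close>)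
    moreover have "N \<noteq> N'" using N \<open>e \<notin> N'\<close> by auto
    moreover have "f \<in> E" using f N by (auto simp: factor_def)
    ultimately have "num f = 2" using one_or_two[of f] by auto
    then show ?thesis using same_num[OF N f(1)] by simp
  qed
  have "\<exists>N2. fac N2 \<and> e \<in> N2 \<and> N2 \<noteq> N"
  proof (rule ccontr)
    assume "\<not> ?thesis"
    then have "{N. fac N \<and> e \<in> N} = {N}" using N by blast
    then show False using two by simp
  qed
  then obtain N2 where N2: "fac N2" "e \<in> N2" "N2 \<noteq> N" by blast
  have N2M: "N2 \<inter> M = {}" using fac_disjoint_M[OF N2(1,2)] e by auto
  obtain g where g: "g \<in> N2" "g \<notin> N" using fac_subset_eq[OF N2(1) N(1)] N2(3) by blast
  have gE: "g \<in> E - M" using g N2 N2M by (auto simp: factor_def)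
  have "t g \<noteq> t e"
    using bij_betw_inj_on_same[of t N2 V g e] N2 g N by (auto simp: factor_def)
  define N3 where "N3 = insert g {x \<in> N. t x \<noteq> t g}"
  have N3: "fac N3" unfolding N3_def by (rule fac_exchange[OF N(1) NM gE])
  have "e \<in> N3" using N \<open>t g \<noteq> t e\<close> by (auto simp: N3_def)
  have "\<not> V \<subseteq> {t e, t g}"
  proof
    assume "V \<subseteq> {t e, t g}"
    then have "card V \<le> card {t e, t g}" by (intro card_mono) auto
    also have "\<dots> \<le> 2" by (simp add: card_insert_if)
    finally show False using n by simp
  qed
  then obtain y where y: "y \<in> V" "y \<noteq> t e" "y \<noteq> t g" by auto
  obtain f where f: "f \<in> N" "t f = y" using fac_edge[OF N(1) y(1)] by auto
  have "card {N, N', N3} \<le> num f"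
    by (rule card_mono[OF finite_facs'])
      (use N N' N3 f y eq in \<open>auto simp: N'_def N3_def\<close>)
  moreover have "N \<noteq> N'" "N3 \<noteq> N'" using N \<open>e \<notin> N'\<close> \<open>e \<in> N3\<close> by auto
  moreover have "N \<noteq> N3" using g by (auto simp: N3_def)
  moreover have "f \<in> E" using f N by (auto simp: factor_def)
  ultimately show False using one_or_two[of f] by auto
qed

lemma out_nonempty:
  assumes "card V \<ge> 2" "v \<in> V"
  shows "\<exists>e\<in>E - M. t e = v"
proof -
  obtain K where K: "fac K" "K \<inter> M = {}" using other_fac[OF assms(1)] .
  then have "K \<subseteq> E - M" by (auto simp: factor_def)
  then show ?thesis using fac_edge[OF K(1) assms(2)] by blast
qed

text \<open>On two vertices a factor other than \<open>M\<close> is a free choice of one arc out of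
  each, so fixing \<open>e\<close> leaves the choice at \<open>w\<close>.\<close>

lemma num_pair:
  assumes V: "V = {v, w}" "v \<noteq> w" and e: "e \<in> E - M" "t e = v"
  shows "num e = card {f \<in> E - M. t f = w}"
    and "f \<in> E - M \<Longrightarrow> t f = w \<Longrightarrow> fac {e, f}"
proof -
  have "card V \<ge> 2" using V by simp
  then obtain K where K: "fac K" "K \<inter> M = {}" by (rule other_fac)
  have pair: "fac {e, f}" if "f \<in> E - M" "t f = w" for f
    by (rule fac_section[OF K]) (use that e V in \<open>auto simp: bij_betw_def\<close>)
  then show "f \<in> E - M \<Longrightarrow> t f = w \<Longrightarrow> fac {e, f}" .
  have "{N. fac N \<and> e \<in> N} = (\<lambda>f. {e, f}) ` {f \<in> E - M. t f = w}"
  proof (intro equalityI subsetI)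
    fix N assume "N \<in> {N. fac N \<and> e \<in> N}"
    then have N: "fac N" "e \<in> N" by auto
    obtain f where f: "f \<in> N" "t f = w" using fac_edge[OF N(1), of w] V by auto
    have "f \<in> E - M" using fac_disjoint_M[OF N] e f N by (auto simp: factor_def)
    moreover have "N = {e, f}"
      using fac_subset_eq[OF pair[OF \<open>f \<in> E - M\<close> f(2)] N(1)] N f by auto
    ultimately show "N \<in> (\<lambda>f. {e, f}) ` {f \<in> E - M. t f = w}" using f by auto
  qed (use pair in auto)
  moreover have "inj_on (\<lambda>f. {e, f}) {f \<in> E - M. t f = w}"
    by (auto simp: inj_on_def doubleton_eq_iff)
  ultimately show "num e = card {f \<in> E - M. t f = w}" by (simp add: card_image)
qed

text \<open>For two vertices, \<open>num_pair\<close> reads each out-degree as the count of an arc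
  leaving the other vertex. Two such arcs form a factor, so by \<open>same_num\<close> the counts
  agree.\<close>

lemma out_card:
  assumes n: "card V \<ge> 2"
  obtains c where "\<And>v. v \<in> V \<Longrightarrow> card {e \<in> E - M. t e = v} = c" "c = 1 \<or> c = 2 \<and> card V = 2"
proof (cases "card V = 2")
  case True
  then obtain v w where V: "V = {v, w}" "v \<noteq> w" by (auto simp: card_2_iff)
  have V': "V = {w, v}" "w \<noteq> v" using V by auto
  obtain e where e: "e \<in> E - M" "t e = v" using out_nonempty[OF n, of v] V by auto
  obtain f where f: "f \<in> E - M" "t f = w" using out_nonempty[OF n, of w] V by auto
  have "num e = num f" using same_num[OF num_pair(2)[OF V e f]] by auto
  then have "card {f \<in> E - M. t f = w} = num e" "card {f \<in> E - M. t f = v} = num e"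
    using num_pair(1)[OF V e] num_pair(1)[OF V' f] by auto
  then show ?thesis using that[of "num e"] one_or_two[of e] e V True by auto
next
  case False
  then have n3: "card V \<ge> 3" using n by simp
  have "card {e \<in> E - M. t e = v} = 1" if "v \<in> V" for v
  proof -
    obtain e where e: "e \<in> E - M" "t e = v" using out_nonempty[OF n \<open>v \<in> V\<close>] by auto
    have "{e \<in> E - M. t e = v} = {e}"
    proof (intro equalityI subsetI)
      fix x assume "x \<in> {e \<in> E - M. t e = v}"
      then show "x \<in> {e}" using out_singleton[OF n3 _ e(1), of x] e(2) by simp
    qed (use e in simp)
    then show ?thesis by simp
  qed
  then show ?thesis using that[of 1] by simp
qed

end

section \<open>Arc multiplicities when every edge is a 2-matching edge\<close>

context two_system
begin

lemma card_V_cases: "card V = 2 \<or> card V = 3"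
proof -
  have "card V \<noteq> 0" using finite_A A_nonempty by simp
  moreover have "card V \<noteq> 1"
  proof
    assume "card V = 1"
    then obtain v where v: "V = {v}" by (rule card_1_singletonE)
    then obtain K where "circ K" "K \<noteq> {}" "v \<notin> t ` K" using avoid_ex1[of v] by auto
    then show False using circ_tails[of K] v by auto
  qed
  ultimately show ?thesis using card_V_le_3 by linarith
qed

text \<open>A circ through an arc \<open>f\<close> from \<open>w\<close> to \<open>u\<close> returns
  by exactly one arc from \<open>u\<close> to \<open>w\<close>, so \<open>num f\<close> counts the
  returning arcs.\<close>

lemma card_arcs_2:
  assumes V: "V = {u, w}" "u \<noteq> w"
  shows "card {e \<in> E. t e = u \<and> h e = w} = 2"
proof -
  have "{w} \<noteq> V" using V by auto
  then obtain f where f: "f \<in> E - M" "t f = w" "h f \<noteq> w"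
    using closed_imp_all[of "{w}"] V by auto
  then have hf: "h f = u" using b_in[of f] V by auto
  let ?X = "{e \<in> E. t e = u \<and> h e = w}"
  have XM: "e \<notin> M" if "e \<in> ?X" for e using that M_loops V by auto
  have "{K. circ K \<and> f \<in> K} = (\<lambda>e. {e, f}) ` ?X"
  proof (intro equalityI subsetI)
    fix K assume "K \<in> {K. circ K \<and> f \<in> K}"
    then have K: "circ K" "f \<in> K" by auto
    have "u \<in> h ` K" using K(2) hf by blast
    then have "u \<in> t ` K" using K(1) by (simp add: circ_def)
    then obtain e where e: "e \<in> K" "t e = u" by auto
    have tK: "inj_on t K" and hK: "inj_on h K" and KE: "K \<subseteq> E - M"
      using K(1) by (auto simp: circ_def)
    have "e \<noteq> f" using e f V by auto
    then have "h e \<noteq> u" using inj_onD[OF hK, of e f] e K(2) hf by auto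
    then have "h e = w" using b_in[of e] e KE V by auto
    moreover have "x \<in> {e, f}" if "x \<in> K" for x
    proof -
      have "t x = t e \<or> t x = t f" using a_in[of x] that KE V e f by auto
      then show ?thesis using inj_onD[OF tK _ that] e K(2) by auto
    qed
    ultimately show "K \<in> (\<lambda>e. {e, f}) ` ?X" using e K(2) KE by blast
  next
    fix K assume "K \<in> (\<lambda>e. {e, f}) ` ?X"
    then obtain e where e: "e \<in> ?X" "K = {e, f}" by auto
    have "circ {e, f}" using e(1) XM[OF e(1)] f hf V by (auto simp: circ_def)
    then show "K \<in> {K. circ K \<and> f \<in> K}" using e by simp
  qed
  moreover have "inj_on (\<lambda>e. {e, f}) ?X" by (auto simp: inj_on_def doubleton_eq_iff)
  ultimately have "card ?X = num f" using num_arc[OF f(1)] by (simp add: card_image)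
  then show ?thesis using two f by simp
qed

text \<open>One loop comes from \<open>M\<close>; the other is the unique nonempty circ avoiding
  \<open>w\<close>, which can only be a loop at \<open>u\<close>.\<close>

lemma card_loops_2:
  assumes V: "V = {u, w}" "u \<noteq> w"
  shows "card {e \<in> E. t e = u \<and> h e = u} = 2"
proof -
  obtain K where K: "circ K" "K \<noteq> {}" "w \<notin> t ` K" using avoid_ex1[of w] V by blast
  have KE: "K \<subseteq> E - M" and hK: "t ` K = h ` K" using K(1) by (auto simp: circ_def)
  have tu: "t ` K = {u}" using K(2,3) circ_tails[OF K(1)] V by auto
  obtain k where k: "k \<in> K" using K(2) by auto
  have tk: "t k = u" "h k = u" using k tu hK by auto
  obtain m where m: "m \<in> M" "t m = u" using fac_edge[OF M_factor, of u] V by auto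
  have "e = m \<or> e = k" if e: "e \<in> E" "t e = u" "h e = u" for e
  proof (cases "e \<in> M")
    case True
    then show ?thesis using bij_betw_inj_on_same[OF M_t, of e m] m e by simp
  next
    case False
    then have "circ {e}" using e by (auto simp: circ_def)
    then have "{e} = K" using avoid_unique[of w "{e}" K] K V e by auto
    then show ?thesis using k by auto
  qed
  then have "{e \<in> E. t e = u \<and> h e = u} \<subseteq> {m, k}" by blast
  moreover have "{m, k} \<subseteq> {e \<in> E. t e = u \<and> h e = u}"
    using m k tk KE M_sub M_loops[of m] by auto
  ultimately have "{e \<in> E. t e = u \<and> h e = u} = {m, k}" by (rule equalityI)
  moreover have "m \<noteq> k" using m k KE by auto
  ultimately show ?thesis by simp
qed

text \<open>Including the loop of \<open>M\<close>, at least three edges have tail \<open>u\<close>.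
  Without parallel arcs their heads are distinct, so they reach each of the three vertices
  once.\<close>

lemma card_arcs_3:
  assumes n: "card V = 3" and u: "u \<in> V" and w: "w \<in> V"
  shows "card {e \<in> E. t e = u \<and> h e = w} = 1"
proof -
  have n3: "card V \<ge> 3" using n by simp
  let ?O = "{e \<in> E. t e = u}"
  have inj: "inj_on h ?O" using no_parallel[OF n3] by (auto intro: inj_onI)
  have "3 \<le> card ?O" using degree[OF u] many_facs by simp
  then have "h ` ?O = V"
    using card_image[OF inj] b_in n finite_A by (intro card_seteq) auto
  then obtain e where e: "e \<in> ?O" "h e = w" using w by blast
  have "{e \<in> E. t e = u \<and> h e = w} = {e}"
  proof (intro equalityI subsetI)
    fix x assume "x \<in> {e \<in> E. t e = u \<and> h e = w}"
    then show "x \<in> {e}" using no_parallel[OF n3, of x e] e by simp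
  qed (use e in simp)
  then show ?thesis by simp
qed

end

subsection \<open>Isomorphisms\<close>

lemma graph_iso_sym:
  assumes iso: "G \<cong>\<^sub>g H" and G: "\<And>e. e \<in> edges G \<Longrightarrow> ends G e \<subseteq> verts G"
  shows "H \<cong>\<^sub>g G"
proof -
  obtain \<phi> \<psi> where \<phi>: "bij_betw \<phi> (verts G) (verts H)" and \<psi>: "bij_betw \<psi> (edges G) (edges H)"
    and ends: "\<And>e. e \<in> edges G \<Longrightarrow> ends H (\<psi> e) = \<phi> ` ends G e"
    using iso by (auto simp: graph_iso_def)
  have "ends G (inv_into (edges G) \<psi> e) = inv_into (verts G) \<phi> ` ends H e" if e: "e \<in> edges H" for e
  proof -
    let ?e = "inv_into (edges G) \<psi> e"
    have e': "?e \<in> edges G" "\<psi> ?e = e"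
      using \<psi> e by (auto simp: bij_betw_def intro: inv_into_into f_inv_into_f)
    then have "ends H e = \<phi> ` ends G ?e" using ends by fastforce
    then show ?thesis using \<phi> G[OF e'(1)] by (simp add: bij_betw_def inv_into_image_cancel)
  qed
  then show ?thesis
    unfolding graph_iso_def using bij_betw_inv_into[OF \<phi>] bij_betw_inv_into[OF \<psi>] by blast
qed

lemma graph_iso_trans:
  assumes "G \<cong>\<^sub>g H" "H \<cong>\<^sub>g K"
  shows "G \<cong>\<^sub>g K"
proof -
  obtain \<phi> \<psi> where 1: "bij_betw \<phi> (verts G) (verts H)" "bij_betw \<psi> (edges G) (edges H)"
    "\<And>e. e \<in> edges G \<Longrightarrow> ends H (\<psi> e) = \<phi> ` ends G e"
    using assms(1) by (auto simp: graph_iso_def)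
  obtain \<phi>' \<psi>' where 2: "bij_betw \<phi>' (verts H) (verts K)" "bij_betw \<psi>' (edges H) (edges K)"
    "\<And>e. e \<in> edges H \<Longrightarrow> ends K (\<psi>' e) = \<phi>' ` ends H e"
    using assms(2) by (auto simp: graph_iso_def)
  have "ends K ((\<psi>' \<circ> \<psi>) e) = (\<phi>' \<circ> \<phi>) ` ends G e" if "e \<in> edges G" for e
    using 1(3)[OF that] 2(3)[OF bij_betwE[OF 1(2), rule_format, OF that]] by (simp add: image_comp)
  then show ?thesis
    unfolding graph_iso_def using bij_betw_trans[OF 1(1) 2(1)] bij_betw_trans[OF 1(2) 2(2)] by blast
qed

lemma multiply_edges_one_iso: "multiply_edges (\<lambda>_. 1) H \<cong>\<^sub>g H"
  unfolding graph_iso_def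
proof (intro exI conjI ballI)
  show "bij_betw id (verts (multiply_edges (\<lambda>_. 1) H)) (verts H)"
    by (simp add: multiply_edges_def)
  show "bij_betw fst (edges (multiply_edges (\<lambda>_. 1) H)) (edges H)"
    by (force simp: multiply_edges_def bij_betw_def inj_on_def)
  show "ends H (fst e) = id ` ends (multiply_edges (\<lambda>_. 1) H) e" for e
    by (simp add: multiply_edges_def case_prod_unfold)
qed

text \<open>\<open>key\<close> sorts the edges of \<open>G\<close> into parallel classes, labelled
  injectively by \<open>\<kappa>\<close>. Any enumeration of a class matches it with the copies of
  \<open>k\<close>, so an isomorphism reduces to a vertex bijection and the sizes of the
  classes.\<close>

lemma multiply_edges_iso:
  assumes \<phi>: "bij_betw \<phi> (verts H) (verts G)" and fin: "finite (edges G)"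
    and inj: "inj_on \<kappa> (edges H)" and key: "\<And>e. e \<in> edges G \<Longrightarrow> key e \<in> \<kappa> ` edges H"
    and card: "\<And>k. k \<in> edges H \<Longrightarrow> card {e \<in> edges G. key e = \<kappa> k} = \<mu> k"
    and ends: "\<And>k e. k \<in> edges H \<Longrightarrow> e \<in> edges G \<Longrightarrow> key e = \<kappa> k \<Longrightarrow> ends G e = \<phi> ` ends H k"
  shows "multiply_edges \<mu> H \<cong>\<^sub>g G"
proof -
  let ?F = "\<lambda>k. {e \<in> edges G. key e = \<kappa> k}"
  have "\<exists>g. bij_betw g {..<\<mu> k} (?F k)" if "k \<in> edges H" for k
    using ex_bij_betw_nat_finite[of "?F k"] fin card[OF that] by (simp add: lessThan_atLeast0)
  then obtain g where g: "\<And>k. k \<in> edges H \<Longrightarrow> bij_betw (g k) {..<\<mu> k} (?F k)" by metis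
  have gF: "g k j \<in> ?F k" if "k \<in> edges H" "j < \<mu> k" for k j
    using bij_betwE[OF g[OF that(1)]] that(2) by simp
  let ?\<psi> = "\<lambda>(k, j). g k j"
  have "inj_on ?\<psi> (Sigma (edges H) (\<lambda>k. {..<\<mu> k}))"
  proof (rule inj_onI)
    fix x y
    assume xy: "x \<in> Sigma (edges H) (\<lambda>k. {..<\<mu> k})" "y \<in> Sigma (edges H) (\<lambda>k. {..<\<mu> k})" "?\<psi> x = ?\<psi> y"
    obtain k j k' j' where x: "x = (k, j)" and y: "y = (k', j')" by (cases x, cases y)
    have k: "k \<in> edges H" "j < \<mu> k" "k' \<in> edges H" "j' < \<mu> k'" and eq: "g k j = g k' j'"
      using xy x y by auto
    have "\<kappa> k = \<kappa> k'" using gF[of k j] gF[of k' j'] k eq by simp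
    then have "k = k'" using inj k by (auto dest: inj_onD)
    then show "x = y" using bij_betw_inj_on_same[OF g[OF k(1)], of j j'] k eq x y by simp
  qed
  moreover have "?\<psi> ` Sigma (edges H) (\<lambda>k. {..<\<mu> k}) = edges G"
  proof (intro equalityI subsetI)
    fix e assume e: "e \<in> edges G"
    then obtain k where k: "k \<in> edges H" "key e = \<kappa> k" using key by blast
    then have "e \<in> g k ` {..<\<mu> k}" using g[OF k(1)] e by (simp add: bij_betw_def)
    then obtain j where "j < \<mu> k" "e = g k j" by auto
    then show "e \<in> ?\<psi> ` Sigma (edges H) (\<lambda>k. {..<\<mu> k})"
      using k by (intro image_eqI[of _ _ "(k, j)"]) auto
  qed (use gF in auto)
  ultimately have \<psi>: "bij_betw ?\<psi> (edges (multiply_edges \<mu> H)) (edges G)"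
    by (simp add: bij_betw_def multiply_edges_def)
  have "ends G (?\<psi> e) = \<phi> ` ends (multiply_edges \<mu> H) e" if e: "e \<in> edges (multiply_edges \<mu> H)" for e
  proof -
    obtain k j where kj: "e = (k, j)" by (cases e)
    then have "k \<in> edges H" "j < \<mu> k" using e by (auto simp: multiply_edges_def)
    then show ?thesis using gF[of k j] ends[of k "g k j"] kj by (simp add: multiply_edges_def)
  qed
  moreover have "bij_betw \<phi> (verts (multiply_edges \<mu> H)) (verts G)"
    using \<phi> by (simp add: multiply_edges_def)
  ultimately show ?thesis unfolding graph_iso_def using \<psi> by blast
qed

lemma Suc_mod_image:
  assumes "n > 0"
  shows "(\<lambda>i. Suc i mod n) ` {..<n} = {..<n}"
proof (intro equalityI subsetI)
  fix j assume j: "j \<in> {..<n}"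
  show "j \<in> (\<lambda>i. Suc i mod n) ` {..<n}"
  proof (cases j)
    case 0
    then show ?thesis using assms by (intro image_eqI[of _ _ "n - 1"]) auto
  next
    case (Suc i)
    then show ?thesis using j by (intro image_eqI[of _ _ i]) auto
  qed
qed (use assms in auto)

lemma Suc_mod_inj: "n > 0 \<Longrightarrow> inj_on (\<lambda>i. Suc i mod n) {..<n}"
  using Suc_mod_image[of n] by (intro eq_card_imp_inj_on) auto

text \<open>\<open>V\<close> is one colour class and \<open>pt\<close> maps a vertex to its partner
  under \<open>M\<close>; an arc from x to y stands for an edge between x and the partner of
  y.\<close>

locale graph_arcs = arc_system V "edges G" t h M
  for G :: "('v, 'e) pre_multigraph" and V :: "'v set" and t h M +
  fixes pt :: "'v \<Rightarrow> 'v"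
  assumes verts_eq: "verts G = V \<union> pt ` V"
    and pt_disj: "V \<inter> pt ` V = {}"
    and pt_inj: "inj_on pt V"
    and ends_eq: "e \<in> edges G \<Longrightarrow> ends G e = {t e, pt (h e)}"
    and pm_iff: "perfect_matching G N \<longleftrightarrow> fac N"
begin

text \<open>Undoing the contraction splits every vertex of a directed cycle into itself and its
  partner. Loops and arcs to the next vertex then alternate around a cycle of twice the
  length.\<close>

lemma iso_multicycle:
  assumes n: "card V = n" "n \<ge> 2" and p: "bij_betw p {..<n} V"
    and loops: "\<And>v. v \<in> V \<Longrightarrow> card {e \<in> edges G. t e = v \<and> h e = v} = c'"
    and arcs: "\<And>i. i < n \<Longrightarrow> card {e \<in> edges G. t e = p i \<and> h e = p (Suc i mod n)} = c"
    and all: "\<And>e. e \<in> edges G \<Longrightarrow> h e \<noteq> t e \<Longrightarrow> \<exists>i<n. t e = p i \<and> h e = p (Suc i mod n)"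
  shows "multiply_edges (\<lambda>k. if even k then c else c') (cycle_graph (2 * n)) \<cong>\<^sub>g G"
proof -
  define s where "s i = Suc i mod n" for i
  have s: "s i < n" if "i < n" for i using that by (simp add: s_def)
  have s_img: "s ` {..<n} = {..<n}" and s_inj: "inj_on s {..<n}"
    using Suc_mod_image[of n] Suc_mod_inj[of n] n(2) by (auto simp: s_def[abs_def])
  have s_ne: "s i \<noteq> i" if "i < n" for i
    using that n(2) by (cases "Suc i = n") (auto simp: s_def)
  have p_eq: "p i = p j \<longleftrightarrow> i = j" if "i < n" "j < n" for i j
    using bij_betw_inj_on_same[OF p, of i j] that by auto
  have pV: "p i \<in> V" if "i < n" for i using bij_betwE[OF p] that by simp
  have Vp: "\<exists>i<n. v = p i" if "v \<in> V" for v using p that by (auto simp: bij_betw_def)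
  have Vs: "\<exists>i<n. v = p (s i)" if v: "v \<in> V" for v
  proof -
    obtain j where j: "j < n" "v = p j" using Vp[OF v] by auto
    then have "j \<in> s ` {..<n}" using s_img by simp
    then show ?thesis using j by auto
  qed
  \<comment> \<open>Position \<open>2 * i\<close> is \<open>p i\<close> and position
    \<open>2 * i + 1\<close> is the partner of the next vertex \<open>p (s i)\<close>. So edge
    \<open>2 * i\<close> carries the arcs from \<open>p i\<close> to \<open>p (s i)\<close>, and
    edge \<open>2 * i + 1\<close> the loops at \<open>p (s i)\<close>.\<close>
  define \<phi> where "\<phi> k = (if even k then p (k div 2) else pt (p (s (k div 2))))" for k
  define \<kappa> where "\<kappa> k = (if even k then (p (k div 2), p (s (k div 2)))
    else (p (s (k div 2)), p (s (k div 2))))" for k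
  have vH: "verts (cycle_graph (2 * n)) = {..<2 * n}" and eH: "edges (cycle_graph (2 * n)) = {..<2 * n}"
    by (simp_all add: cycle_graph_def)
  have half: "k div 2 < n" if "k < 2 * n" for k using that by auto
  show ?thesis
  proof (rule multiply_edges_iso[where \<phi> = \<phi> and \<kappa> = \<kappa> and key = "\<lambda>e. (t e, h e)"])
    have "\<phi> ` {..<2 * n} = V \<union> pt ` V"
    proof (intro equalityI subsetI)
      fix x assume "x \<in> \<phi> ` {..<2 * n}"
      then show "x \<in> V \<union> pt ` V" using pV s half by (auto simp: \<phi>_def)
    next
      fix x assume "x \<in> V \<union> pt ` V"
      then consider "x \<in> V" | v where "v \<in> V" "x = pt v" by blast
      then show "x \<in> \<phi> ` {..<2 * n}"
      proof cases
        case 1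
        then obtain i where "i < n" "x = p i" using Vp by auto
        then show ?thesis by (intro image_eqI[of _ _ "2 * i"]) (auto simp: \<phi>_def)
      next
        case 2
        then obtain i where "i < n" "v = p (s i)" using Vs by auto
        then show ?thesis using 2 by (intro image_eqI[of _ _ "Suc (2 * i)"]) (auto simp: \<phi>_def)
      qed
    qed
    moreover have "card (V \<union> pt ` V) = 2 * n"
      using card_Un_disjoint[OF finite_A _ pt_disj] finite_A card_image[OF pt_inj] n by simp
    ultimately have "inj_on \<phi> {..<2 * n}" by (intro eq_card_imp_inj_on) auto
    then show "bij_betw \<phi> (verts (cycle_graph (2 * n))) (verts G)"
      using \<open>\<phi> ` {..<2 * n} = V \<union> pt ` V\<close> by (simp add: vH verts_eq bij_betw_def)
    show "inj_on \<kappa> (edges (cycle_graph (2 * n)))"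
      unfolding eH
    proof (rule inj_onI)
      fix k l assume k: "k \<in> {..<2 * n}" and l: "l \<in> {..<2 * n}" and eq: "\<kappa> k = \<kappa> l"
      have kl: "k div 2 < n" "l div 2 < n" using k l by auto
      note p_eqs = p_eq[OF kl] p_eq[OF kl(1) s[OF kl(2)]] p_eq[OF s[OF kl(1)] kl(2)]
        p_eq[OF s[OF kl(1)] s[OF kl(2)]]
      have "s (k div 2) = s (l div 2) \<longleftrightarrow> k div 2 = l div 2"
        using inj_onD[OF s_inj, of "k div 2" "l div 2"] kl by auto
      then have "even k = even l \<and> k div 2 = l div 2"
        using eq s_ne[OF kl(1)] s_ne[OF kl(2)] p_eqs
        by (cases "even k"; cases "even l") (simp_all add: \<kappa>_def)
      then show "k = l" by (metis even_two_times_div_two odd_two_times_div_two_succ)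
    qed
    show "(t e, h e) \<in> \<kappa> ` edges (cycle_graph (2 * n))" if e: "e \<in> edges G" for e
    proof (cases "h e = t e")
      case True
      obtain i where "i < n" "t e = p (s i)" using Vs[OF a_in[OF e]] by auto
      then show ?thesis
        unfolding eH using True by (intro image_eqI[of _ _ "Suc (2 * i)"]) (auto simp: \<kappa>_def)
    next
      case False
      then obtain i where "i < n" "t e = p i" "h e = p (s i)" using all[OF e] by (auto simp: s_def)
      then show ?thesis
        unfolding eH by (intro image_eqI[of _ _ "2 * i"]) (auto simp: \<kappa>_def)
    qed
    fix k assume "k \<in> edges (cycle_graph (2 * n))"
    then have k: "k < 2 * n" by (simp add: eH)
    show "card {e \<in> edges G. (t e, h e) = \<kappa> k} = (if even k then c else c')"
      using loops[OF pV[OF s[OF half[OF k]]]] arcs[OF half[OF k]] by (simp add: \<kappa>_def s_def)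
    fix e assume e: "e \<in> edges G" "(t e, h e) = \<kappa> k"
    show "ends G e = \<phi> ` ends (cycle_graph (2 * n)) k"
    proof (cases "even k")
      case True
      then have "Suc k mod (2 * n) = Suc k" using k by (auto elim: evenE)
      then show ?thesis
        using e True by (simp add: ends_eq cycle_graph_def \<phi>_def \<kappa>_def insert_commute)
    next
      case False
      then obtain i where i: "k = 2 * i + 1" by (auto elim: oddE)
      have "Suc k mod (2 * n) = 2 * s i" unfolding i s_def by (simp add: mult_mod_right)
      then show ?thesis
        using e False i by (simp add: ends_eq cycle_graph_def \<phi>_def \<kappa>_def insert_commute)
    qed
  qed (rule finite_E)
qed

lemma iso_K33:
  assumes n: "card V = 3" and all: "\<And>u w. u \<in> V \<Longrightarrow> w \<in> V \<Longrightarrow> card {e \<in> edges G. t e = u \<and> h e = w} = 1"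
  shows "multiply_edges (\<lambda>_. 1) (complete_bipartite 3 3) \<cong>\<^sub>g G"
proof -
  obtain p where p: "bij_betw p {..<3::nat} V"
    using ex_bij_betw_nat_finite[OF finite_A] n by (auto simp: lessThan_atLeast0)
  have V: "V = p ` {..<3}" and p_inj: "inj_on p {..<3}" using p by (auto simp: bij_betw_def)
  define \<phi> where "\<phi> = case_sum p (\<lambda>j. pt (p j))"
  define \<kappa> where "\<kappa> = (\<lambda>(i, j). (p i, p j))"
  have vH: "verts (complete_bipartite 3 3) = {..<3} <+> {..<3}"
    and eH: "edges (complete_bipartite 3 3) = {..<3} \<times> {..<3}"
    by (simp_all add: complete_bipartite_def)
  show ?thesis
  proof (rule multiply_edges_iso[where \<phi> = \<phi> and \<kappa> = \<kappa> and key = "\<lambda>e. (t e, h e)"])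
    have "\<phi> ` ({..<3} <+> {..<3}) = V \<union> pt ` V"
      unfolding V by (auto simp: \<phi>_def Plus_def image_Un image_image)
    moreover have "card (V \<union> pt ` V) = 6"
      using card_Un_disjoint[OF finite_A _ pt_disj] finite_A card_image[OF pt_inj] n by simp
    moreover have "card ({..<3::nat} <+> {..<3::nat}) = 6" by (simp add: card_Plus)
    ultimately show "bij_betw \<phi> (verts (complete_bipartite 3 3)) (verts G)"
      unfolding vH verts_eq bij_betw_def by (auto intro!: eq_card_imp_inj_on)
    show "inj_on \<kappa> (edges (complete_bipartite 3 3))"
      unfolding eH \<kappa>_def using p_inj by (auto simp: inj_on_def)
    show "(t e, h e) \<in> \<kappa> ` edges (complete_bipartite 3 3)" if e: "e \<in> edges G" for e
    proof -
      obtain i j where "i < 3" "t e = p i" "j < 3" "h e = p j"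
        using a_in[OF e] b_in[OF e] V by auto
      then show ?thesis
        unfolding eH by (intro image_eqI[of _ _ "(i, j)"]) (auto simp: \<kappa>_def)
    qed
    fix k assume "k \<in> edges (complete_bipartite 3 3)"
    then obtain i j where k: "k = (i, j)" "i < 3" "j < 3" by (auto simp: eH)
    show "card {e \<in> edges G. (t e, h e) = \<kappa> k} = 1"
      using all[of "p i" "p j"] k V by (simp add: \<kappa>_def)
    show "ends G e = \<phi> ` ends (complete_bipartite 3 3) k" if "e \<in> edges G" "(t e, h e) = \<kappa> k" for e
      using that k by (simp add: ends_eq \<kappa>_def \<phi>_def complete_bipartite_def)
  qed (rule finite_E)
qed

lemma iso_K2_star:
  assumes n: "card V = 1"
  shows "\<exists>m\<ge>1. G \<cong>\<^sub>g K2_star m"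
proof -
  obtain v where V: "V = {v}" using n by (rule card_1_singletonE)
  have ne: "pt v \<noteq> v" using pt_disj V by auto
  obtain \<psi> where \<psi>: "bij_betw \<psi> (edges G) {..<card (edges G)}"
    using ex_bij_betw_finite_nat[OF finite_E] by (auto simp: lessThan_atLeast0)
  obtain m where "m \<in> M" using M_t V by (auto simp: bij_betw_def)
  then have "card (edges G) \<noteq> 0" using M_sub finite_E by auto
  moreover have "G \<cong>\<^sub>g K2_star (card (edges G))"
    unfolding graph_iso_def
  proof (intro exI conjI ballI)
    show "bij_betw (\<lambda>x. if x = v then 0 else 1) (verts G) (verts (K2_star (card (edges G))))"
      using ne by (auto simp: verts_eq V K2_star_def bij_betw_def inj_on_def)
    show "bij_betw \<psi> (edges G) (edges (K2_star (card (edges G))))"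
      using \<psi> by (simp add: K2_star_def)
    show "ends (K2_star (card (edges G))) (\<psi> e) = (\<lambda>x. if x = v then 0 else 1) ` ends G e"
      if "e \<in> edges G" for e
      using ends_eq[OF that] a_in[OF that] b_in[OF that] V ne by (auto simp: K2_star_def)
  qed
  ultimately show ?thesis by (intro exI[of _ "card (edges G)"]) auto
qed

end

section \<open>From a bipartite graph to its contracted digraph\<close>

lemma bipartite_perfect_matching_iff:
  assumes AB: "A \<union> B = verts G" "A \<inter> B = {}"
    and ab: "\<And>e. e \<in> edges G \<Longrightarrow> a e \<in> A \<and> b e \<in> B \<and> ends G e = {a e, b e}"
  shows "perfect_matching G N \<longleftrightarrow> factor A B (edges G) a b N"
proof (cases "N \<subseteq> edges G")
  case True
  have "ends G e \<inter> ends G f = {} \<longleftrightarrow> a e \<noteq> a f \<and> b e \<noteq> b f" if "e \<in> N" "f \<in> N" for e f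
  proof -
    have "e \<in> edges G" "f \<in> edges G" using that True by auto
    from ab[OF this(1)] ab[OF this(2)] show ?thesis using AB(2) by auto
  qed
  then have 1: "matching G N \<longleftrightarrow> inj_on a N \<and> inj_on b N"
    using True unfolding matching_def inj_on_def by blast
  have "(\<Union>e\<in>N. ends G e) = a ` N \<union> b ` N" using ab True by blast
  moreover have "a ` N \<union> b ` N = A \<union> B \<longleftrightarrow> a ` N = A \<and> b ` N = B"
  proof -
    have "a ` N \<subseteq> A" "b ` N \<subseteq> B" using ab True by blast+
    then show ?thesis using AB(2) by blast
  qed
  ultimately show ?thesis
    using True 1 AB(1) by (auto simp: perfect_matching_def factor_def bij_betw_def)
qed (simp add: perfect_matching_def matching_def factor_def)

lemma bipartite_graph_arcs:
  assumes G: "multigraph G" "bipartite G" "matching_covered G" and M: "perfect_matching G M"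
  obtains V t h pt where "graph_arcs G V t h M pt"
proof -
  interpret multigraph G by (rule G(1))
  obtain A B where AB: "A \<union> B = verts G" "A \<inter> B = {}"
    and AB_ends: "\<And>e. e \<in> edges G \<Longrightarrow> \<exists>a\<in>A. \<exists>b\<in>B. ends G e = {a, b}"
    using G(2) by (auto simp: bipartite_def)
  obtain a b where ab: "\<And>e. e \<in> edges G \<Longrightarrow> a e \<in> A \<and> b e \<in> B \<and> ends G e = {a e, b e}"
    using AB_ends by metis
  have conn: "connected_graph G" using G(3) by (simp add: matching_covered_def)
  note pm = bipartite_perfect_matching_iff[OF AB ab]
  interpret C: covered_system A B "edges G" a b
  proof
    show "finite A" using finite_verts AB by (metis finite_Un)
    show "finite (edges G)" by (rule finite_edges)
    show "a e \<in> A" "b e \<in> B" if "e \<in> edges G" for e using ab[OF that] by auto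
    show "A \<noteq> {}"
    proof -
      have "verts G \<noteq> {}" using conn by (simp add: connected_graph_def)
      then obtain e where "e \<in> M" using M by (auto simp: perfect_matching_def)
      then show ?thesis using M ab by (auto simp: perfect_matching_def matching_def)
    qed
    show "\<exists>N. factor A B (edges G) a b N \<and> e \<in> N" if "e \<in> edges G" for e
      using G(3) that pm by (auto simp: matching_covered_def)
    show "S = A" if S: "S \<subseteq> A" and T: "T \<subseteq> B" and ne: "S \<noteq> {}"
      and closed: "\<And>e. e \<in> edges G \<Longrightarrow> a e \<in> S \<longleftrightarrow> b e \<in> T" for S T
    proof -
      obtain u where u: "u \<in> S" using ne by auto
      \<comment> \<open>From reachability to cuts: no edge leaves \<open>S \<union> T\<close>, so it
        contains everything reachable from \<open>u\<close>.\<close>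
      have closed_step: "w \<in> S \<union> T" if v: "v \<in> S \<union> T" and vw: "(v, w) \<in> adjacency G" for v w
      proof -
        obtain e where e: "e \<in> edges G" "ends G e = {v, w}" using vw by (auto simp: adjacency_def)
        have eq: "{v, w} = {a e, b e}" using ab[OF e(1)] e(2) by simp
        have "a e \<in> S \<union> T \<longleftrightarrow> a e \<in> S" "b e \<in> S \<union> T \<longleftrightarrow> b e \<in> T"
          using ab[OF e(1)] S T AB(2) by auto
        then show ?thesis using closed[OF e(1)] eq v by (auto simp: doubleton_eq_iff)
      qed
      have "v \<in> S \<union> T" if "(u, v) \<in> (adjacency G)\<^sup>*" for v
        using that
      proof induction
        case base
        show ?case using u by simp
      next
        case (step y z)
        show ?case by (rule closed_step[OF step.IH step.hyps(2)])
      qed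
      moreover have "u \<in> verts G" using u S AB by auto
      ultimately have "verts G \<subseteq> S \<union> T" using conn by (auto simp: connected_graph_def)
      then show "S = A" using S T AB by blast
    qed
  qed
  have MF: "factor A B (edges G) a b M" using M pm by simp
  let ?g = "\<lambda>y. a (inv_into M b y)"
  let ?pt = "\<lambda>x. b (inv_into M a x)"
  have Ma: "bij_betw a M A" and Mb: "bij_betw b M B" using MF by (auto simp: factor_def)
  have pt: "bij_betw ?pt A B"
    using bij_betw_trans[OF bij_betw_inv_into[OF Ma] Mb] by (simp add: comp_def)
  have pt_g: "?pt (?g y) = y" if "y \<in> B" for y
  proof -
    have "inv_into M b y \<in> M" "b (inv_into M b y) = y"
      using Mb that by (auto simp: bij_betw_def intro: inv_into_into f_inv_into_f)
    then show ?thesis using Ma by (simp add: bij_betw_inv_into_left)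
  qed
  have "graph_arcs G A a (\<lambda>e. ?g (b e)) M ?pt"
  proof (intro graph_arcs.intro graph_arcs_axioms.intro C.rebase_arc_system[OF MF])
    show "verts G = A \<union> ?pt ` A" "A \<inter> ?pt ` A = {}" "inj_on ?pt A"
      using pt AB by (auto simp: bij_betw_def)
    show "ends G e = {a e, ?pt (?g (b e))}" if "e \<in> edges G" for e
      using ab[OF that] pt_g by simp
    show "perfect_matching G N \<longleftrightarrow> factor A A (edges G) a (\<lambda>e. ?g (b e)) N" for N
      using pm C.rebase_factor[OF MF] by simp
  qed
  then show ?thesis by (rule that)
qed

section \<open>Identifying the graph from its digraph\<close>

lemma C4_4_eq: "C4_4 = multiply_edges (\<lambda>k. if even k then 2 else 2) (cycle_graph (2 * 2))"
  by (simp add: C4_4_def)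

text \<open>The two multiplicity functions agree only on the four edges of the cycle, so the edge
  sets are compared instead of the functions.\<close>

lemma C4_2_eq: "C4_2 = multiply_edges (\<lambda>k. if even k then 2 else 1) (cycle_graph (2 * 2))"
proof -
  have "k \<in> {0, 2} \<longleftrightarrow> even k" if "k < 4" for k :: nat
  proof -
    have "k = 0 \<or> k = 1 \<or> k = 2 \<or> k = 3" using that by linarith
    then show ?thesis by auto
  qed
  then have "Sigma {..<4::nat} (\<lambda>k. {..<if k \<in> {0, 2} then 2 else 1::nat})
      = Sigma {..<4} (\<lambda>k. {..<if even k then 2 else 1})"
    by (intro Sigma_cong) auto
  then show ?thesis by (simp add: C4_2_def multiply_edges_def cycle_graph_def)
qed

context graph_arcs
begin

lemma iso_of_two:
  assumes "two_system V (edges G) t h M"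
  shows "C4_4 \<cong>\<^sub>g G \<or> complete_bipartite 3 3 \<cong>\<^sub>g G"
proof -
  interpret two_system V "edges G" t h M by (rule assms)
  consider "card V = 2" | "card V = 3" using card_V_cases by auto
  then show ?thesis
  proof cases
    case 1
    then obtain u w where V: "V = {u, w}" "u \<noteq> w" by (auto simp: card_2_iff)
    then have V': "V = {w, u}" "w \<noteq> u" by auto
    define p where "p i = (if i = 0 then u else w)" for i :: nat
    have two: "{..<2::nat} = {0, 1}" by auto
    have "multiply_edges (\<lambda>k. if even k then 2 else 2) (cycle_graph (2 * 2)) \<cong>\<^sub>g G"
    proof (rule iso_multicycle[of 2 p])
      show "bij_betw p {..<2} V" using V by (auto simp: bij_betw_def two p_def)
      show "card {e \<in> edges G. t e = v \<and> h e = v} = 2" if "v \<in> V" for v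
        using that card_loops_2[OF V] card_loops_2[OF V'] V by auto
      show "card {e \<in> edges G. t e = p i \<and> h e = p (Suc i mod 2)} = 2" if "i < 2" for i
      proof -
        have "i = 0 \<or> i = 1" using that by auto
        then show ?thesis using card_arcs_2[OF V] card_arcs_2[OF V'] by (auto simp: p_def)
      qed
      show "\<exists>i<2. t e = p i \<and> h e = p (Suc i mod 2)" if "e \<in> edges G" "h e \<noteq> t e" for e
      proof -
        have "t e = u \<and> h e = w \<or> t e = w \<and> h e = u"
          using a_in[OF that(1)] b_in[OF that(1)] that(2) V by auto
        then show ?thesis
        proof
          assume "t e = u \<and> h e = w"
          then show ?thesis by (intro exI[of _ 0]) (simp add: p_def)
        next
          assume "t e = w \<and> h e = u"
          then show ?thesis by (intro exI[of _ 1]) (simp add: p_def)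
        qed
      qed
    qed (use 1 in auto)
    then show ?thesis by (simp only: C4_4_eq simp_thms)
  next
    case 2
    have "multiply_edges (\<lambda>_. 1) (complete_bipartite 3 3) \<cong>\<^sub>g G"
      by (rule iso_K33[OF 2 card_arcs_3[OF 2]])
    moreover have "complete_bipartite 3 3 \<cong>\<^sub>g multiply_edges (\<lambda>_. 1) (complete_bipartite 3 3)"
      by (rule graph_iso_sym[OF multiply_edges_one_iso])
        (auto simp: multiply_edges_def complete_bipartite_def)
    ultimately show ?thesis using graph_iso_trans by blast
  qed
qed

text \<open>From two vertices on, the cyclic order leaves no loops but those of \<open>M\<close>, so
  the odd edges of the cycle are simple and the out-degree \<open>c\<close> alone separates
  \<open>C4_2\<close> from a cycle.\<close>

lemma iso_of_one_two:
  assumes "one_two_system V (edges G) t h M"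
  shows "(\<exists>m\<ge>1. G \<cong>\<^sub>g K2_star m) \<or> C4_2 \<cong>\<^sub>g G \<or> (\<exists>n\<ge>2. cycle_graph (2 * n) \<cong>\<^sub>g G)"
proof (cases "card V = 1")
  case True
  then show ?thesis using iso_K2_star by blast
next
  case False
  interpret one_two_system V "edges G" t h M by (rule assms)
  have "card V \<noteq> 0" using finite_A A_nonempty by simp
  with False have n: "card V \<ge> 2" by linarith
  obtain p where p: "bij_betw p {..<card V} V"
    and next_p: "\<And>e i. e \<in> edges G - M \<Longrightarrow> i < card V \<Longrightarrow> t e = p i \<Longrightarrow> h e = p (Suc i mod card V)"
    by (rule cyclic_order[OF n]) (rule that)
  obtain c where c: "\<And>v. v \<in> V \<Longrightarrow> card {e \<in> edges G - M. t e = v} = c"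
    and c12: "c = 1 \<or> c = 2 \<and> card V = 2"
    by (rule out_card[OF n]) (rule that)
  have p_ne: "p (Suc i mod card V) \<noteq> p i" if i: "i < card V" for i
  proof
    assume "p (Suc i mod card V) = p i"
    then have "Suc i mod card V = i" using bij_betw_inj_on_same[OF p, of "Suc i mod card V" i] i by auto
    then show False using i n by (cases "Suc i = card V") auto
  qed
  have pV: "p i \<in> V" if "i < card V" for i using bij_betwE[OF p] that by simp
  have pos: "\<exists>i<card V. t e = p i" if "e \<in> edges G" for e
    using p a_in[OF that] by (auto simp: bij_betw_def)
  have arc: "t e \<noteq> h e" if e: "e \<in> edges G - M" for e
  proof -
    obtain i where "i < card V" "t e = p i" using pos e by blast
    then show ?thesis using next_p[OF e] p_ne[of i] by auto
  qed
  have "multiply_edges (\<lambda>k. if even k then c else 1) (cycle_graph (2 * card V)) \<cong>\<^sub>g G"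
  proof (rule iso_multicycle[OF refl n p])
    show "card {e \<in> edges G. t e = v \<and> h e = v} = 1" if v: "v \<in> V" for v
    proof -
      obtain m where m: "m \<in> M" "t m = v" using fac_edge[OF M_factor v] by auto
      have "{e \<in> edges G. t e = v \<and> h e = v} = {m}"
      proof (intro equalityI subsetI)
        fix e assume "e \<in> {e \<in> edges G. t e = v \<and> h e = v}"
        then have e: "e \<in> edges G" "t e = v" "h e = v" by auto
        then have "e \<in> M" using arc[of e] by auto
        then show "e \<in> {m}" using bij_betw_inj_on_same[OF M_t, of e m] e m by simp
      qed (use m M_sub M_loops in auto)
      then show ?thesis by simp
    qed
    show "card {e \<in> edges G. t e = p i \<and> h e = p (Suc i mod card V)} = c" if i: "i < card V" for i
    proof -
      have "{e \<in> edges G. t e = p i \<and> h e = p (Suc i mod card V)} = {e \<in> edges G - M. t e = p i}"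
      proof (intro equalityI subsetI)
        fix e assume "e \<in> {e \<in> edges G. t e = p i \<and> h e = p (Suc i mod card V)}"
        then show "e \<in> {e \<in> edges G - M. t e = p i}" using M_loops[of e] p_ne[OF i] by auto
      qed (use next_p[OF _ i] in auto)
      then show ?thesis using c[OF pV[OF i]] by simp
    qed
    show "\<exists>i<card V. t e = p i \<and> h e = p (Suc i mod card V)" if e: "e \<in> edges G" "h e \<noteq> t e" for e
    proof -
      have "e \<in> edges G - M" using e M_loops by auto
      moreover obtain i where "i < card V" "t e = p i" using pos[OF e(1)] by auto
      ultimately show ?thesis using next_p by auto
    qed
  qed
  note iso = this
  from c12 show ?thesis
  proof
    assume "c = 1"
    then have "multiply_edges (\<lambda>_. 1) (cycle_graph (2 * card V)) \<cong>\<^sub>g G"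
      using iso by (simp only: if_cancel)
    moreover have "cycle_graph (2 * card V) \<cong>\<^sub>g multiply_edges (\<lambda>_. 1) (cycle_graph (2 * card V))"
      by (rule graph_iso_sym[OF multiply_edges_one_iso])
        (use n in \<open>auto simp: multiply_edges_def cycle_graph_def\<close>)
    ultimately show ?thesis using graph_iso_trans n by blast
  next
    assume "c = 2 \<and> card V = 2"
    then have "C4_2 \<cong>\<^sub>g G" using iso by (simp only: C4_2_eq)
    then show ?thesis by simp
  qed
qed

end

text \<open>The conditions of \<open>class_B\<close> on perfect matchings alone. The other
  conditions are hypotheses on \<open>G\<close>, so for the converse only these are transferred
  along an isomorphism.\<close>

definition one_or_two_matchings :: "('v, 'e) pre_multigraph \<Rightarrow> bool" where
  "one_or_two_matchings G \<longleftrightarrow> (\<exists>M. perfect_matching G M) \<and>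
     (\<forall>e\<in>edges G. k_matching_edge G 1 e \<or> k_matching_edge G 2 e) \<and>
     \<not> (\<exists>M. perfect_matching G M \<and>
          (\<exists>e\<in>M. \<exists>f\<in>M. k_matching_edge G 1 e \<and> k_matching_edge G 2 f))"

lemma class_B_iff:
  "G \<in> class_B \<longleftrightarrow> multigraph G \<and> connected_graph G \<and> one_or_two_matchings G"
  by (simp add: class_B_def one_or_two_matchings_def)

lemma class_B_imp_iso:
  assumes G: "multigraph G" "bipartite G" "matching_covered G" and B: "one_or_two_matchings G"
  shows "(\<exists>m\<ge>1. G \<cong>\<^sub>g K2_star m) \<or> C4_2 \<cong>\<^sub>g G \<or> C4_4 \<cong>\<^sub>g G \<or>
    complete_bipartite 3 3 \<cong>\<^sub>g G \<or> (\<exists>n\<ge>2. cycle_graph (2 * n) \<cong>\<^sub>g G)"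
proof (cases "\<exists>e\<in>edges G. k_matching_edge G 1 e")
  case True
  then obtain e where e: "e \<in> edges G" "k_matching_edge G 1 e" by auto
  then obtain M where M: "perfect_matching G M" "e \<in> M" using G(3) by (auto simp: matching_covered_def)
  then obtain V t h pt where "graph_arcs G V t h M pt" using bipartite_graph_arcs[OF G] by blast
  then interpret graph_arcs G V t h M pt .
  have k: "k_matching_edge G k f \<longleftrightarrow> f \<in> edges G \<and> num f = k" for k f
    by (simp add: k_matching_edge_def pm_iff)
  have one: "num f = 1" if "f \<in> M" for f
    using B M e that M_sub unfolding one_or_two_matchings_def k by blast
  have "one_two_system V (edges G) t h M"
  proof unfold_locales
    show "num m = 1" if "m \<in> M" for m by (rule one[OF that])
    show 12: "num f = 1 \<or> num f = 2" if "f \<in> edges G" for f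
      using B that unfolding one_or_two_matchings_def k by blast
    show "num f = num g" if N: "fac N" "f \<in> N" "g \<in> N" for N f g
    proof -
      have fg: "f \<in> edges G" "g \<in> edges G" using N by (auto simp: factor_def)
      have mixed: "\<not> (num x = 1 \<and> num y = 2)" if "x \<in> N" "y \<in> N" "x \<in> edges G" "y \<in> edges G" for x y
        using B N(1) that unfolding one_or_two_matchings_def k pm_iff by blast
      show ?thesis
        using mixed[OF N(2,3) fg] mixed[OF N(3,2) fg(2,1)] 12[OF fg(1)] 12[OF fg(2)] by linarith
    qed
  qed
  from iso_of_one_two[OF this] show ?thesis by blast
next
  case False
  obtain M where M: "perfect_matching G M" using B by (auto simp: one_or_two_matchings_def)
  then obtain V t h pt where "graph_arcs G V t h M pt" using bipartite_graph_arcs[OF G] by blast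
  then interpret graph_arcs G V t h M pt .
  have "two_system V (edges G) t h M"
  proof unfold_locales
    show "num f = 2" if "f \<in> edges G" for f
      using B False that by (auto simp: one_or_two_matchings_def k_matching_edge_def pm_iff)
  qed
  from iso_of_two[OF this] show ?thesis by blast
qed

subsection \<open>Perfect matchings of the listed graphs\<close>

lemma one_or_two_matchings_iso:
  assumes iso: "G \<cong>\<^sub>g H" and "multigraph G" and H: "one_or_two_matchings H"
  shows "one_or_two_matchings G"
proof -
  note G = multigraph.ends_in_verts[OF \<open>multigraph G\<close>]
  obtain \<phi> \<psi> where \<phi>: "bij_betw \<phi> (verts G) (verts H)" and \<psi>: "bij_betw \<psi> (edges G) (edges H)"
    and ends: "\<And>e. e \<in> edges G \<Longrightarrow> ends H (\<psi> e) = \<phi> ` ends G e"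
    using iso by (auto simp: graph_iso_def)
  have \<phi>_inj: "inj_on \<phi> (verts G)" and \<psi>_inj: "inj_on \<psi> (edges G)" and \<psi>_img: "\<psi> ` edges G = edges H"
    using \<phi> \<psi> by (auto simp: bij_betw_def)
  have pm: "perfect_matching H (\<psi> ` N) \<longleftrightarrow> perfect_matching G N" if N: "N \<subseteq> edges G" for N
  proof -
    have disj: "ends H (\<psi> e) \<inter> ends H (\<psi> f) = {} \<longleftrightarrow> ends G e \<inter> ends G f = {}"
      if "e \<in> N" "f \<in> N" for e f
    proof -
      have ef: "e \<in> edges G" "f \<in> edges G" using that N by auto
      have "\<phi> ` ends G e \<inter> \<phi> ` ends G f = \<phi> ` (ends G e \<inter> ends G f)"
        by (rule inj_on_image_Int[OF \<phi>_inj G[OF ef(1)] G[OF ef(2)], symmetric])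
      then show ?thesis using ends[OF ef(1)] ends[OF ef(2)] by simp
    qed
    have ne: "\<psi> e = \<psi> f \<longleftrightarrow> e = f" if "e \<in> N" "f \<in> N" for e f
      using that N inj_on_eq_iff[OF \<psi>_inj] by blast
    have "\<psi> ` N \<subseteq> edges H" using N \<psi>_img by blast
    then have 1: "matching H (\<psi> ` N) \<longleftrightarrow> matching G N"
      using N disj ne by (simp add: matching_def)
    have "(\<Union>e\<in>\<psi> ` N. ends H e) = \<phi> ` (\<Union>e\<in>N. ends G e)"
      using ends N by (simp add: image_UN subset_iff)
    moreover have "(\<Union>e\<in>N. ends G e) \<subseteq> verts G" using G N by blast
    moreover have "\<phi> ` verts G = verts H" using \<phi> by (simp add: bij_betw_def)
    ultimately have "(\<Union>e\<in>\<psi> ` N. ends H e) = verts H \<longleftrightarrow> (\<Union>e\<in>N. ends G e) = verts G"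
      using inj_on_image_eq_iff[OF \<phi>_inj, of "\<Union>e\<in>N. ends G e" "verts G"] by simp
    then show ?thesis using 1 by (simp add: perfect_matching_def)
  qed
  have sub: "N \<subseteq> edges G" if "perfect_matching G N" for N
    using that by (simp add: perfect_matching_def matching_def)
  have subH: "N \<subseteq> edges H" if "perfect_matching H N" for N
    using that by (simp add: perfect_matching_def matching_def)
  have ex: "\<exists>N'. perfect_matching G N' \<and> N = \<psi> ` N'" if N: "perfect_matching H N" for N
  proof -
    obtain N' where "N' \<subseteq> edges G" "N = \<psi> ` N'"
      using subH[OF N] \<psi>_img by (metis subset_imageE)
    then show ?thesis using N pm by auto
  qed
  have mem: "\<psi> e \<in> \<psi> ` N \<longleftrightarrow> e \<in> N" if "e \<in> edges G" "N \<subseteq> edges G" for e N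
    using inj_on_image_mem_iff[OF \<psi>_inj that] .
  have k: "k_matching_edge H k (\<psi> e) \<longleftrightarrow> k_matching_edge G k e" if e: "e \<in> edges G" for k e
  proof -
    have "{N. perfect_matching H N \<and> \<psi> e \<in> N} = image \<psi> ` {N. perfect_matching G N \<and> e \<in> N}"
    proof (intro equalityI subsetI)
      fix N assume N: "N \<in> {N. perfect_matching H N \<and> \<psi> e \<in> N}"
      then obtain N' where "perfect_matching G N'" "N = \<psi> ` N'" using ex by blast
      then show "N \<in> image \<psi> ` {N. perfect_matching G N \<and> e \<in> N}"
        using N mem[OF e sub] by auto
    next
      fix N assume "N \<in> image \<psi> ` {N. perfect_matching G N \<and> e \<in> N}"
      then obtain N' where "perfect_matching G N'" "e \<in> N'" "N = \<psi> ` N'" by auto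
      then show "N \<in> {N. perfect_matching H N \<and> \<psi> e \<in> N}" using pm[OF sub] by auto
    qed
    moreover have "inj_on (image \<psi>) {N. perfect_matching G N \<and> e \<in> N}"
      by (rule inj_on_subset[OF inj_on_image_Pow[OF \<psi>_inj]]) (use sub in auto)
    ultimately have "card {N. perfect_matching H N \<and> \<psi> e \<in> N} = card {N. perfect_matching G N \<and> e \<in> N}"
      by (simp add: card_image)
    moreover have "\<psi> e \<in> edges H" using e \<psi>_img by blast
    ultimately show ?thesis using e by (simp add: k_matching_edge_def)
  qed
  show ?thesis
    unfolding one_or_two_matchings_def
  proof (intro conjI ballI notI)
    show "\<exists>M. perfect_matching G M" using H ex unfolding one_or_two_matchings_def by blast
    show "k_matching_edge G 1 e \<or> k_matching_edge G 2 e" if e: "e \<in> edges G" for e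
    proof -
      have "\<psi> e \<in> edges H" using e \<psi>_img by blast
      then show ?thesis using H k[OF e] by (auto simp: one_or_two_matchings_def)
    qed
    assume "\<exists>M. perfect_matching G M \<and> (\<exists>e\<in>M. \<exists>f\<in>M. k_matching_edge G 1 e \<and> k_matching_edge G 2 f)"
    then obtain M e f where M: "perfect_matching G M" "e \<in> M" "f \<in> M"
      and ef: "k_matching_edge G 1 e" "k_matching_edge G 2 f" by auto
    have "e \<in> edges G" "f \<in> edges G" using M sub by auto
    then have "k_matching_edge H 1 (\<psi> e)" "k_matching_edge H 2 (\<psi> f)" using ef k by auto
    then show False using H M pm[OF sub[OF M(1)]] unfolding one_or_two_matchings_def by blast
  qed
qed

text \<open>A count that is the same for all edges excludes mixing. Of the listed graphs only
  \<open>C4_2\<close> has both counts and is treated separately.\<close>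

lemma one_or_two_matchingsI:
  assumes "perfect_matching G M" and "k \<in> {1, 2}"
    and "\<And>e. e \<in> edges G \<Longrightarrow> card {N. perfect_matching G N \<and> e \<in> N} = k"
  shows "one_or_two_matchings G"
  unfolding one_or_two_matchings_def
proof (intro conjI ballI notI)
  show "k_matching_edge G 1 e \<or> k_matching_edge G 2 e" if "e \<in> edges G" for e
    using assms(2) assms(3)[OF that] that by (auto simp: k_matching_edge_def)
  show False if "\<exists>M. perfect_matching G M \<and> (\<exists>e\<in>M. \<exists>f\<in>M. k_matching_edge G 1 e \<and> k_matching_edge G 2 f)"
    using that assms(3) by (auto simp: k_matching_edge_def)
qed (use assms(1) in auto)

lemma K2_star_matchings:
  assumes "m \<ge> 1"
  shows "one_or_two_matchings (K2_star m)"
proof (rule one_or_two_matchingsI[where k = 1])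
  have pm: "perfect_matching (K2_star m) N \<longleftrightarrow> (\<exists>e<m. N = {e})" for N
  proof
    assume N: "perfect_matching (K2_star m) N"
    have "N \<noteq> {}"
    proof
      assume "N = {}"
      then show False using N by (simp add: perfect_matching_def K2_star_def)
    qed
    then obtain e where e: "e \<in> N" by auto
    moreover have "N \<subseteq> {e}"
    proof
      fix f assume "f \<in> N"
      then have "ends (K2_star m) f \<inter> ends (K2_star m) e = {}" if "f \<noteq> e"
        using N e that unfolding perfect_matching_def matching_def by blast
      then show "f \<in> {e}" by (auto simp: K2_star_def)
    qed
    ultimately have "N = {e}" by blast
    moreover have "e < m" using N e by (auto simp: perfect_matching_def matching_def K2_star_def)
    ultimately show "\<exists>e<m. N = {e}" by blast
  next
    assume "\<exists>e<m. N = {e}"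
    then obtain e where "e < m" "N = {e}" by blast
    then show "perfect_matching (K2_star m) N"
      by (simp add: perfect_matching_def matching_def K2_star_def)
  qed
  show "perfect_matching (K2_star m) {0}" using assms pm by auto
  fix e assume "e \<in> edges (K2_star m)"
  then have "e < m" by (simp add: K2_star_def)
  then have "{N. perfect_matching (K2_star m) N \<and> e \<in> N} = {{e}}" using pm by auto
  then show "card {N. perfect_matching (K2_star m) N \<and> e \<in> N} = 1" by simp
qed simp

section \<open>Perfect matchings of even cycles\<close>

lemma even_Suc_mod: "even (n::nat) \<Longrightarrow> even (Suc k mod n) \<longleftrightarrow> odd k"
  by (simp add: dvd_mod_iff)

text \<open>The length is even, so the cyclic successor changes parity even at the wrap-around.
  Edges of equal parity are therefore disjoint, and the two edges at a vertex have different
  parity.\<close>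

lemma cycle_perfect_matching:
  assumes n: "n \<ge> 2" and r: "r < 2"
  shows "perfect_matching (cycle_graph (2 * n)) {k. k < 2 * n \<and> k mod 2 = r}"
    (is "perfect_matching ?C ?N")
proof -
  let ?s = "\<lambda>k. Suc k mod (2 * n)"
  have par: "?s k mod 2 \<noteq> k mod 2" for k
  proof
    assume "?s k mod 2 = k mod 2"
    then have "even (?s k) \<longleftrightarrow> even k" by (simp only: even_iff_mod_2_eq_zero)
    then show False using even_Suc_mod[of "2 * n" k] by simp
  qed
  have "ends ?C e \<inter> ends ?C f = {}" if "e \<in> ?N" "f \<in> ?N" "e \<noteq> f" for e f
  proof -
    have "?s e \<noteq> ?s f" using inj_onD[OF Suc_mod_inj, of "2 * n" e f] that by auto
    moreover have "e \<noteq> ?s f" "f \<noteq> ?s e" using par[of e] par[of f] that by auto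
    ultimately show ?thesis using that(3) by (auto simp: cycle_graph_def)
  qed
  moreover have "(\<Union>e\<in>?N. ends ?C e) = {..<2 * n}"
  proof (intro equalityI subsetI)
    fix v assume "v \<in> (\<Union>e\<in>?N. ends ?C e)"
    then show "v \<in> {..<2 * n}" using n by (auto simp: cycle_graph_def)
  next
    fix v assume v: "v \<in> {..<2 * n}"
    show "v \<in> (\<Union>e\<in>?N. ends ?C e)"
    proof (cases "v mod 2 = r")
      case True
      then show ?thesis using v by (auto simp: cycle_graph_def)
    next
      case False
      have "v \<in> ?s ` {..<2 * n}" using Suc_mod_image[of "2 * n"] v n by auto
      then obtain k where k: "k < 2 * n" "v = ?s k" by auto
      have "v mod 2 \<noteq> k mod 2" using par[of k] k(2) by simp
      moreover have "v mod 2 < 2" "k mod 2 < 2" by simp_all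
      ultimately have "k mod 2 = r" using False r by linarith
      then show ?thesis using k by (auto simp: cycle_graph_def)
    qed
  qed
  ultimately show ?thesis by (auto simp: perfect_matching_def matching_def cycle_graph_def)
qed

text \<open>The vertex \<open>?s k\<close> is an end of the edges \<open>k\<close> and
  \<open>?s k\<close> only, and exactly one of them is in \<open>N\<close>. Membership thus
  alternates and is settled by edge 0.\<close>

lemma cycle_perfect_matching_cases:
  assumes n: "n \<ge> 2" and N: "perfect_matching (cycle_graph (2 * n)) N"
  shows "\<exists>r<2. N = {k. k < 2 * n \<and> k mod 2 = r}"
proof -
  let ?s = "\<lambda>k. Suc k mod (2 * n)"
  let ?C = "cycle_graph (2 * n)"
  have sub: "N \<subseteq> {..<2 * n}" using N by (auto simp: perfect_matching_def matching_def cycle_graph_def)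
  have ends: "ends ?C k = {k, ?s k}" for k by (simp add: cycle_graph_def)
  have s_inj: "k = l" if "?s k = ?s l" "k < 2 * n" "l < 2 * n" for k l
    using inj_onD[OF Suc_mod_inj, of "2 * n" k l] that by auto
  have alt: "?s k \<in> N \<longleftrightarrow> k \<notin> N" if k: "k < 2 * n" for k
  proof
    assume "?s k \<in> N"
    show "k \<notin> N"
    proof
      assume "k \<in> N"
      moreover have "k \<noteq> ?s k" using k n by (cases "Suc k = 2 * n") auto
      moreover have "?s k \<in> ends ?C k \<inter> ends ?C (?s k)" by (simp add: ends)
      ultimately show False
        using N \<open>?s k \<in> N\<close> unfolding perfect_matching_def matching_def by blast
    qed
  next
    assume "k \<notin> N"
    have "?s k \<in> verts ?C" using n by (simp add: cycle_graph_def)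
    then obtain l where l: "l \<in> N" "?s k = l \<or> ?s k = ?s l"
      using N unfolding perfect_matching_def by (auto simp: ends simp del: mod_Suc)
    then show "?s k \<in> N" using s_inj[of k l] k sub \<open>k \<notin> N\<close> by auto
  qed
  have par: "k \<in> N \<longleftrightarrow> (even k \<longleftrightarrow> 0 \<in> N)" if "k < 2 * n" for k
    using that
  proof (induction k)
    case (Suc k)
    then show ?case using alt[of k] by auto
  qed simp
  define r :: nat where "r = (if 0 \<in> N then 0 else 1)"
  have "N = {k. k < 2 * n \<and> k mod 2 = r}"
  proof (intro equalityI subsetI)
    fix k assume k: "k \<in> N"
    then have "k < 2 * n" using sub by auto
    then show "k \<in> {k. k < 2 * n \<and> k mod 2 = r}" using par[of k] k by (auto simp: r_def even_iff_mod_2_eq_zero odd_iff_mod_2_eq_one)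
  next
    fix k assume "k \<in> {k. k < 2 * n \<and> k mod 2 = r}"
    then show "k \<in> N" using par[of k] by (auto simp: r_def even_iff_mod_2_eq_zero split: if_splits)
  qed
  moreover have "r < 2" by (simp add: r_def)
  ultimately show ?thesis by blast
qed

lemma cycle_matchings:
  assumes n: "n \<ge> 2"
  shows "one_or_two_matchings (cycle_graph (2 * n))"
proof (rule one_or_two_matchingsI[where k = 1])
  show "perfect_matching (cycle_graph (2 * n)) {k. k < 2 * n \<and> k mod 2 = 0}"
    by (rule cycle_perfect_matching[OF n]) simp
  fix e assume "e \<in> edges (cycle_graph (2 * n))"
  then have e: "e < 2 * n" by (simp add: cycle_graph_def)
  have "{N. perfect_matching (cycle_graph (2 * n)) N \<and> e \<in> N} = {{k. k < 2 * n \<and> k mod 2 = e mod 2}}"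
  proof (intro equalityI subsetI)
    fix N assume "N \<in> {N. perfect_matching (cycle_graph (2 * n)) N \<and> e \<in> N}"
    then show "N \<in> {{k. k < 2 * n \<and> k mod 2 = e mod 2}}"
      using cycle_perfect_matching_cases[OF n, of N] by auto
  qed (use cycle_perfect_matching[OF n, of "e mod 2"] e in auto)
  then show "card {N. perfect_matching (cycle_graph (2 * n)) N \<and> e \<in> N} = 1" by simp
qed simp

text \<open>Two copies of one edge meet because its set of ends is nonempty, so a perfect matching
  is one of \<open>H\<close> with a copy chosen for each of its edges.\<close>

lemma multiply_edges_perfect_matching:
  assumes ne: "\<And>e. e \<in> edges H \<Longrightarrow> ends H e \<noteq> {}"
  shows "perfect_matching (multiply_edges \<mu> H) N \<longleftrightarrow>
    N \<subseteq> Sigma (edges H) (\<lambda>e. {..<\<mu> e}) \<and> inj_on fst N \<and> perfect_matching H (fst ` N)"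
proof (cases "N \<subseteq> Sigma (edges H) (\<lambda>e. {..<\<mu> e})")
  case True
  have ends: "ends (multiply_edges \<mu> H) x = ends H (fst x)" for x
    by (simp add: multiply_edges_def case_prod_unfold)
  have sub: "fst ` N \<subseteq> edges H" using True by auto
  have "matching (multiply_edges \<mu> H) N \<longleftrightarrow>
      (\<forall>x\<in>N. \<forall>y\<in>N. x \<noteq> y \<longrightarrow> ends H (fst x) \<inter> ends H (fst y) = {})"
    using True by (simp add: matching_def ends) (simp add: multiply_edges_def)
  also have "\<dots> \<longleftrightarrow> inj_on fst N \<and> matching H (fst ` N)"
  proof
    assume disj: "\<forall>x\<in>N. \<forall>y\<in>N. x \<noteq> y \<longrightarrow> ends H (fst x) \<inter> ends H (fst y) = {}"
    have "inj_on fst N"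
    proof (rule inj_onI, rule ccontr)
      fix x y assume xy: "x \<in> N" "y \<in> N" "fst x = fst y" "x \<noteq> y"
      then have "ends H (fst x) = {}" using disj by fastforce
      then show False using ne[of "fst x"] xy sub by auto
    qed
    moreover have "matching H (fst ` N)"
      unfolding matching_def
    proof (intro conjI ballI impI)
      fix k l assume "k \<in> fst ` N" "l \<in> fst ` N" "k \<noteq> l"
      then obtain x y where xy: "x \<in> N" "y \<in> N" "k = fst x" "l = fst y" by (elim imageE)
      then have "x \<noteq> y" using \<open>k \<noteq> l\<close> by auto
      then show "ends H k \<inter> ends H l = {}" using disj xy by blast
    qed (rule sub)
    ultimately show "inj_on fst N \<and> matching H (fst ` N)" by simp
  next
    assume N: "inj_on fst N \<and> matching H (fst ` N)"
    show "\<forall>x\<in>N. \<forall>y\<in>N. x \<noteq> y \<longrightarrow> ends H (fst x) \<inter> ends H (fst y) = {}"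
    proof (intro ballI impI)
      fix x y assume xy: "x \<in> N" "y \<in> N" "x \<noteq> y"
      then have "fst x \<noteq> fst y" using N by (auto dest: inj_onD)
      then show "ends H (fst x) \<inter> ends H (fst y) = {}"
        using N xy unfolding matching_def by blast
    qed
  qed
  finally show ?thesis
    using True by (simp add: perfect_matching_def ends) (simp add: multiply_edges_def)
qed (auto simp: perfect_matching_def matching_def multiply_edges_def)

text \<open>The underlying matching of the 4-cycle is \<open>fst e\<close> with the opposite edge,
  so only the copy of the opposite edge is free.\<close>

lemma multiply_C4_count:
  fixes \<mu> :: "nat \<Rightarrow> nat"
  assumes e: "e \<in> edges (multiply_edges \<mu> (cycle_graph 4))"
  shows "card {N. perfect_matching (multiply_edges \<mu> (cycle_graph 4)) N \<and> e \<in> N} =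
    \<mu> ((fst e + 2) mod 4)"
proof -
  obtain k j where kj: "e = (k, j)" "k < 4" "j < \<mu> k"
    using e by (auto simp: multiply_edges_def cycle_graph_def)
  define l where "l = (k + 2) mod 4"
  have k: "k = 0 \<or> k = 1 \<or> k = 2 \<or> k = 3" using kj by linarith
  have kl: "k = 0 \<and> l = 2 \<or> k = 1 \<and> l = 3 \<or> k = 2 \<and> l = 0 \<or> k = 3 \<and> l = 1"
    using k unfolding l_def by (elim disjE) simp_all
  then have l: "l < 4" "l \<noteq> k" "l mod 2 = k mod 2" by (elim disjE; simp)+
  have residue: "{x. x < 4 \<and> x mod 2 = k mod 2} = {k, l}"
  proof (intro equalityI subsetI)
    fix x assume "x \<in> {x. x < 4 \<and> x mod 2 = k mod 2}"
    then have "x < 4" "x mod 2 = k mod 2" by auto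
    moreover then have "x = 0 \<or> x = 1 \<or> x = 2 \<or> x = 3" by linarith
    ultimately show "x \<in> {k, l}" using kl by auto
  qed (use kj l in auto)
  have C4: "perfect_matching (cycle_graph 4) N \<longleftrightarrow> N = {k, l}" if "k \<in> N" for N
  proof
    assume "perfect_matching (cycle_graph 4) N"
    then obtain r where "N = {x. x < 4 \<and> x mod 2 = r}"
      using cycle_perfect_matching_cases[of 2 N] by auto
    then show "N = {k, l}" using that residue by auto
  next
    assume "N = {k, l}"
    then show "perfect_matching (cycle_graph 4) N"
      using cycle_perfect_matching[of 2 "k mod 2"] residue by simp
  qed
  let ?G = "multiply_edges \<mu> (cycle_graph 4)"
  have pm: "perfect_matching ?G N \<longleftrightarrow>
    N \<subseteq> Sigma {..<4} (\<lambda>e. {..<\<mu> e}) \<and> inj_on fst N \<and> perfect_matching (cycle_graph 4) (fst ` N)" for N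
    by (subst multiply_edges_perfect_matching) (auto simp: cycle_graph_def)
  have "{N. perfect_matching ?G N \<and> e \<in> N} = (\<lambda>i. {e, (l, i)}) ` {..<\<mu> l}"
  proof (intro equalityI subsetI)
    fix N assume "N \<in> {N. perfect_matching ?G N \<and> e \<in> N}"
    then have N: "N \<subseteq> Sigma {..<4} (\<lambda>e. {..<\<mu> e})" "inj_on fst N" "e \<in> N"
      and N': "perfect_matching (cycle_graph 4) (fst ` N)" by (auto simp: pm)
    have "k \<in> fst ` N" using N(3) kj by force
    then have fN: "fst ` N = {k, l}" using C4 N' by blast
    then have "l \<in> fst ` N" by simp
    then obtain i where i: "(l, i) \<in> N" by auto
    have "N \<subseteq> {e, (l, i)}"
    proof
      fix x assume x: "x \<in> N"
      then have "fst x = fst e \<or> fst x = fst (l, i)" using fN kj by auto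
      then show "x \<in> {e, (l, i)}" using inj_onD[OF N(2) _ x N(3)] inj_onD[OF N(2) _ x i] by blast
    qed
    then have "N = {e, (l, i)}" using N(3) i by auto
    then show "N \<in> (\<lambda>i. {e, (l, i)}) ` {..<\<mu> l}" using N(1) i by auto
  next
    fix N assume "N \<in> (\<lambda>i. {e, (l, i)}) ` {..<\<mu> l}"
    then obtain i where i: "i < \<mu> l" "N = {e, (l, i)}" by auto
    have "fst ` N = {k, l}" using i kj by simp
    moreover have "perfect_matching (cycle_graph 4) {k, l}" using C4[of "{k, l}"] by simp
    ultimately have "perfect_matching (cycle_graph 4) (fst ` N)" by simp
    then show "N \<in> {N. perfect_matching ?G N \<and> e \<in> N}"
      using i kj l by (auto simp: pm)
  qed
  moreover have "inj_on (\<lambda>i. {e, (l, i)}) {..<\<mu> l}" by (auto simp: inj_on_def doubleton_eq_iff)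
  ultimately show ?thesis using kj by (simp add: card_image l_def)
qed

lemma multiply_C4_perfect_matching:
  assumes "\<And>k. k < 4 \<Longrightarrow> \<mu> k > 0"
  shows "perfect_matching (multiply_edges \<mu> (cycle_graph 4)) {(0, 0), (2, 0)}"
proof -
  have "{x::nat. x < 4 \<and> x mod 2 = 0} = {0, 2}"
  proof (intro equalityI subsetI)
    fix x :: nat assume "x \<in> {x. x < 4 \<and> x mod 2 = 0}"
    then have "x < 4" "x mod 2 = 0" by auto
    moreover then have "x = 0 \<or> x = 1 \<or> x = 2 \<or> x = 3" by linarith
    ultimately show "x \<in> {0, 2}" by auto
  qed auto
  then have "perfect_matching (cycle_graph 4) {0, 2}" using cycle_perfect_matching[of 2 0] by simp
  then show ?thesis
    using assms by (subst multiply_edges_perfect_matching) (auto simp: cycle_graph_def)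
qed

lemma C4_4_matchings: "one_or_two_matchings C4_4"
proof (rule one_or_two_matchingsI[where k = 2])
  show "perfect_matching C4_4 {(0, 0), (2, 0)}"
    unfolding C4_4_def by (rule multiply_C4_perfect_matching) simp
  show "card {N. perfect_matching C4_4 N \<and> e \<in> N} = 2" if "e \<in> edges C4_4" for e
    using multiply_C4_count that unfolding C4_4_def by blast
qed simp

text \<open>Opposite edges have equal multiplicity, so counts depend only on the parity of
  \<open>fst e\<close>, and a perfect matching stays within one parity.\<close>

lemma C4_2_matchings: "one_or_two_matchings C4_2"
proof -
  let ?\<mu> = "\<lambda>i::nat. if i \<in> {0, 2} then 2 else 1::nat"
  have pm: "perfect_matching C4_2 {(0, 0), (2, 0)}"
    unfolding C4_2_def by (rule multiply_C4_perfect_matching) simp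
  have count: "card {N. perfect_matching C4_2 N \<and> e \<in> N} = (if even (fst e) then 2 else 1)"
    if e: "e \<in> edges C4_2" for e
  proof -
    have "fst e < 4" using e by (auto simp: C4_2_def multiply_edges_def cycle_graph_def)
    then have "fst e = 0 \<or> fst e = 1 \<or> fst e = 2 \<or> fst e = 3" by linarith
    then have "?\<mu> ((fst e + 2) mod 4) = (if even (fst e) then 2 else 1)"
      by (elim disjE) simp_all
    moreover have "card {N. perfect_matching C4_2 N \<and> e \<in> N} = ?\<mu> ((fst e + 2) mod 4)"
      using multiply_C4_count[of e ?\<mu>] e unfolding C4_2_def by blast
    ultimately show ?thesis by simp
  qed
  have parity: "even (fst e) = even (fst f)" if N: "perfect_matching C4_2 N" "e \<in> N" "f \<in> N" for N e f
  proof -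
    have "perfect_matching (cycle_graph 4) (fst ` N)"
      using N(1) unfolding C4_2_def
      by (subst (asm) multiply_edges_perfect_matching) (auto simp: cycle_graph_def)
    then obtain r where r: "fst ` N = {x. x < 4 \<and> x mod 2 = r}"
      using cycle_perfect_matching_cases[of 2 "fst ` N"] by auto
    have "fst e \<in> fst ` N" "fst f \<in> fst ` N" using N by auto
    then have "fst e mod 2 = fst f mod 2" unfolding r by simp
    then show ?thesis by presburger
  qed
  show ?thesis
    unfolding one_or_two_matchings_def
  proof (intro conjI ballI notI)
    show "\<exists>M. perfect_matching C4_2 M" using pm by blast
    show "k_matching_edge C4_2 1 e \<or> k_matching_edge C4_2 2 e" if "e \<in> edges C4_2" for e
      using count[OF that] that by (simp add: k_matching_edge_def)
    assume "\<exists>M. perfect_matching C4_2 M \<and>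
      (\<exists>e\<in>M. \<exists>f\<in>M. k_matching_edge C4_2 1 e \<and> k_matching_edge C4_2 2 f)"
    then obtain M e f where M: "perfect_matching C4_2 M" "e \<in> M" "f \<in> M"
      and ef: "k_matching_edge C4_2 1 e" "k_matching_edge C4_2 2 f" by auto
    have "odd (fst e)" "even (fst f)"
      using ef count[of e] count[of f] unfolding k_matching_edge_def by (auto split: if_splits)
    then show False using parity[OF M] by simp
  qed
qed

section \<open>Perfect matchings of \<open>complete_bipartite 3 3\<close>\<close>

lemma K33_perfect_matching_iff:
  "perfect_matching (complete_bipartite 3 3) N \<longleftrightarrow>
    N \<subseteq> {..<3} \<times> {..<3} \<and> bij_betw fst N {..<3} \<and> bij_betw snd N {..<3}"
proof (cases "N \<subseteq> {..<3} \<times> {..<3}")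
  case True
  let ?K = "complete_bipartite 3 3"
  have ends: "ends ?K x = {Inl (fst x), Inr (snd x)}" for x
    by (simp add: complete_bipartite_def case_prod_unfold)
  have "matching ?K N \<longleftrightarrow> inj_on fst N \<and> inj_on snd N"
    using True unfolding matching_def inj_on_def ends by (auto simp: complete_bipartite_def)
  moreover have "(\<Union>x\<in>N. ends ?K x) = fst ` N <+> snd ` N" by (auto simp: ends)
  moreover have "fst ` N <+> snd ` N = {..<3} <+> {..<3} \<longleftrightarrow> fst ` N = {..<3} \<and> snd ` N = {..<3}"
  proof -
    have "Inl -` (X <+> Y) = X" "Inr -` (X <+> Y) = Y" for X :: "nat set" and Y :: "nat set"
      by auto
    then show ?thesis by metis
  qed
  ultimately show ?thesis
    using True by (auto simp: perfect_matching_def bij_betw_def complete_bipartite_def)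
qed (auto simp: perfect_matching_def matching_def complete_bipartite_def)

lemma three_split:
  assumes "i < (3::nat)"
  obtains i' i'' where "{..<3} = {i, i', i''}" "i \<noteq> i'" "i \<noteq> i''" "i' \<noteq> i''"
proof -
  have three: "{..<3::nat} = {0, 1, 2}" by auto
  consider "i = 0" | "i = 1" | "i = 2" using assms by linarith
  then show ?thesis
  proof cases
    case 1
    then show ?thesis by (intro that[of 1 2]) (simp_all add: three insert_commute)
  next
    case 2
    then show ?thesis by (intro that[of 0 2]) (simp_all add: three insert_commute)
  next
    case 3
    then show ?thesis by (intro that[of 0 1]) (simp_all add: three insert_commute)
  qed
qed

text \<open>Perfect matchings are graphs of permutations; fixing the value \<open>j\<close> at
  \<open>i\<close> leaves the two bijections between the remaining pairs.\<close>

lemma K33_matchings: "one_or_two_matchings (complete_bipartite 3 3)"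
proof (rule one_or_two_matchingsI[where k = 2])
  have three: "{..<3::nat} = {0, 1, 2}" by auto
  show "perfect_matching (complete_bipartite 3 3) {(0, 0), (1, 1), (2, 2)}"
    unfolding K33_perfect_matching_iff three bij_betw_def by auto
  fix e assume "e \<in> edges (complete_bipartite 3 3)"
  then obtain i j where e: "e = (i, j)" "i < 3" "j < 3" by (auto simp: complete_bipartite_def)
  obtain i' i'' where I: "{..<3} = {i, i', i''}" "i \<noteq> i'" "i \<noteq> i''" "i' \<noteq> i''"
    using three_split[OF e(2)] .
  obtain j' j'' where J: "{..<3} = {j, j', j''}" "j \<noteq> j'" "j \<noteq> j''" "j' \<noteq> j''"
    using three_split[OF e(3)] .
  let ?N1 = "{(i, j), (i', j'), (i'', j'')}" and ?N2 = "{(i, j), (i', j''), (i'', j')}"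
  have pm: "perfect_matching (complete_bipartite 3 3) N \<longleftrightarrow>
    N \<subseteq> {i, i', i''} \<times> {j, j', j''} \<and> bij_betw fst N {i, i', i''} \<and> bij_betw snd N {j, j', j''}" for N
    unfolding K33_perfect_matching_iff by (simp only: I(1)[symmetric] J(1)[symmetric])
  have "{N. perfect_matching (complete_bipartite 3 3) N \<and> e \<in> N} = {?N1, ?N2}"
  proof (intro equalityI subsetI)
    fix N assume "N \<in> {N. perfect_matching (complete_bipartite 3 3) N \<and> e \<in> N}"
    then have N: "N \<subseteq> {i, i', i''} \<times> {j, j', j''}" "bij_betw fst N {i, i', i''}"
      "bij_betw snd N {j, j', j''}" "(i, j) \<in> N" by (auto simp: pm e)
    have "i' \<in> fst ` N" "i'' \<in> fst ` N" using N(2) by (auto simp: bij_betw_def)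
    then obtain x y where xy: "(i', x) \<in> N" "(i'', y) \<in> N" by auto
    have col: "p = q" if "p \<in> N" "q \<in> N" "snd p = snd q" for p q
      using bij_betw_inj_on_same[OF N(3) that] .
    have "x \<noteq> j" "y \<noteq> j" "x \<noteq> y"
      using col[OF xy(1) N(4)] col[OF xy(2) N(4)] col[OF xy] I by auto
    moreover have "x \<in> {j, j', j''}" "y \<in> {j, j', j''}" using xy N(1) by auto
    ultimately have "x = j' \<and> y = j'' \<or> x = j'' \<and> y = j'" by auto
    moreover have "N = {(i, j), (i', x), (i'', y)}"
    proof
      show "N \<subseteq> {(i, j), (i', x), (i'', y)}"
      proof
        fix p assume p: "p \<in> N"
        then have "fst p \<in> {i, i', i''}" using N(1) by auto
        then have "fst p = fst (i, j) \<or> fst p = fst (i', x) \<or> fst p = fst (i'', y)" by auto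
        then show "p \<in> {(i, j), (i', x), (i'', y)}"
          using bij_betw_inj_on_same[OF N(2) p] N(4) xy by blast
      qed
    qed (use N(4) xy in auto)
    ultimately show "N \<in> {?N1, ?N2}" by auto
  next
    fix N assume "N \<in> {?N1, ?N2}"
    then show "N \<in> {N. perfect_matching (complete_bipartite 3 3) N \<and> e \<in> N}"
      using I(2-4) J(2-4) unfolding pm bij_betw_def e(1) by auto
  qed
  moreover have "?N1 \<noteq> ?N2"
  proof
    assume "?N1 = ?N2"
    moreover have "(i', j') \<in> ?N1" by simp
    ultimately have "(i', j') \<in> ?N2" by (rule subst)
    then show False using I(2-4) J(2-4) by auto
  qed
  ultimately show "card {N. perfect_matching (complete_bipartite 3 3) N \<and> e \<in> N} = 2" by simp
qed simp

theorem theorem1p6: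
  fixes G :: "('v, 'e) pre_multigraph"
  assumes "multigraph G" and "bipartite G" and "matching_covered G"
  shows "G \<in> class_B \<longleftrightarrow>
    (\<exists>m\<ge>1. G \<cong>\<^sub>g K2_star m) \<or>
    G \<cong>\<^sub>g C4_2 \<or>
    G \<cong>\<^sub>g C4_4 \<or>
    G \<cong>\<^sub>g complete_bipartite 3 3 \<or>
    (\<exists>n\<ge>2. G \<cong>\<^sub>g cycle_graph (2 * n))"
proof
  assume "G \<in> class_B"
  then have iso: "(\<exists>m\<ge>1. G \<cong>\<^sub>g K2_star m) \<or> C4_2 \<cong>\<^sub>g G \<or> C4_4 \<cong>\<^sub>g G \<or>
      complete_bipartite 3 3 \<cong>\<^sub>g G \<or> (\<exists>n\<ge>2. cycle_graph (2 * n) \<cong>\<^sub>g G)"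
    using class_B_imp_iso[OF assms] by (simp add: class_B_iff)
  have "G \<cong>\<^sub>g C4_2" if "C4_2 \<cong>\<^sub>g G"
    by (rule graph_iso_sym[OF that]) (auto simp: C4_2_def multiply_edges_def cycle_graph_def)
  moreover have "G \<cong>\<^sub>g C4_4" if "C4_4 \<cong>\<^sub>g G"
    by (rule graph_iso_sym[OF that]) (auto simp: C4_4_def multiply_edges_def cycle_graph_def)
  moreover have "G \<cong>\<^sub>g complete_bipartite 3 3" if "complete_bipartite 3 3 \<cong>\<^sub>g G"
    by (rule graph_iso_sym[OF that]) (auto simp: complete_bipartite_def)
  moreover have "G \<cong>\<^sub>g cycle_graph (2 * n)" if "cycle_graph (2 * n) \<cong>\<^sub>g G" "n \<ge> 2" for n
    by (rule graph_iso_sym[OF that(1)]) (use that(2) in \<open>auto simp: cycle_graph_def\<close>)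
  ultimately show "(\<exists>m\<ge>1. G \<cong>\<^sub>g K2_star m) \<or> G \<cong>\<^sub>g C4_2 \<or> G \<cong>\<^sub>g C4_4 \<or>
      G \<cong>\<^sub>g complete_bipartite 3 3 \<or> (\<exists>n\<ge>2. G \<cong>\<^sub>g cycle_graph (2 * n))"
    using iso by blast
next
  assume iso: "(\<exists>m\<ge>1. G \<cong>\<^sub>g K2_star m) \<or> G \<cong>\<^sub>g C4_2 \<or> G \<cong>\<^sub>g C4_4 \<or>
      G \<cong>\<^sub>g complete_bipartite 3 3 \<or> (\<exists>n\<ge>2. G \<cong>\<^sub>g cycle_graph (2 * n))"
  note pull_back = one_or_two_matchings_iso[OF _ assms(1)]
  have "one_or_two_matchings G"
    using iso pull_back[OF _ K2_star_matchings] pull_back[OF _ C4_2_matchings]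
      pull_back[OF _ C4_4_matchings] pull_back[OF _ K33_matchings] pull_back[OF _ cycle_matchings]
    by blast
  then show "G \<in> class_B"
    using assms by (simp add: class_B_iff matching_covered_def)
qed

end
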